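(* Let $Z\subset\mathbb{R}^n$ be an $n$-dimensional lattice zonotope. Then for $i=0,\dots,n$, $$\frac{\mathrm{g}_i(Z)}{\mathrm{vol}(Z)}\leq \frac{n!}{i!}\prod_{j=i+1}^n\lambda_j(DZ),$$ and in particular $\mathrm{g}_i(Z)\leq \frac{n!}{i!}\,\sigma_i(Z)$.
   Context: A lattice zonotope is a set $Z=\sum_{i=1}^m[p_i,p_i+v_i]$ with $p_i,v_i\in\mathbb{Z}^n$. $\mathrm{vol}$ is $n$-dimensional Lebesgue measure. For an $n$-dimensional lattice polytope $P$, $\#(kP\cap\mathbb{Z}^n)=\sum_{i=0}^n\mathrm{g}_i(P)k^i$ for $k\in\mathbb{N}$. For a $0$-symmetric convex body $K$, $\lambda_i(K)=\min\{\lambda>0:\dim(\lambda K\cap\mathbb{Z}^n)\ge i\}$ (dimension of the affine hull). $DZ=Z-Z$ and $\sigma_i(Z)=\sigma_i(1/\lambda_1(DZ),\dots,1/\lambda_n(DZ))$, with $\sigma_i$ the $i$th elementary symmetric polynomial. *)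

theory Defs
  imports "HOL-Analysis.Analysis" "HOL-Computational_Algebra.Polynomial"
begin

definition lattice_points :: "(real^'n) set" where
  "lattice_points = {x. \<forall>i. x $ i \<in> \<int>}"

definition lattice_zonotope :: "(real^'n) set \<Rightarrow> bool" where
  "lattice_zonotope Z \<longleftrightarrow>
     (\<exists>ps vs :: (real^'n) list. length ps = length vs \<and>
        set ps \<subseteq> lattice_points \<and> set vs \<subseteq> lattice_points \<and>
        Z = {\<Sum>i<length ps. ps ! i + t i *\<^sub>R vs ! i | t. \<forall>i<length ps. t i \<in> {0..1}})"

definition ehrhart_poly :: "(real^'n) set \<Rightarrow> real poly" where
  "ehrhart_poly P = (THE p. degree p \<le> CARD('n) \<and>
     (\<forall>k::nat. real (card (((\<lambda>x. real k *\<^sub>R x) ` P) \<inter> lattice_points)) = poly p (real k)))"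

definition ehrhart_coeff :: "(real^'n) set \<Rightarrow> nat \<Rightarrow> real" where
  "ehrhart_coeff P i = coeff (ehrhart_poly P) i"

definition diff_body :: "(real^'n) set \<Rightarrow> (real^'n) set" where
  "diff_body Z = {x - y | x y. x \<in> Z \<and> y \<in> Z}"

text \<open>i-th successive minimum of a 0-symmetric convex body K (w.r.t. Z^n),
  dimension measured as that of the affine hull.\<close>
definition succ_min :: "(real^'n) set \<Rightarrow> nat \<Rightarrow> real" where
  "succ_min K i = Inf {l. l > 0 \<and> aff_dim (((\<lambda>x. l *\<^sub>R x) ` K) \<inter> lattice_points) \<ge> int i}"

definition esym :: "nat \<Rightarrow> nat \<Rightarrow> (nat \<Rightarrow> real) \<Rightarrow> real" where
  "esym n i a = (\<Sum>S | S \<subseteq> {1..n} \<and> card S = i. \<Prod>j\<in>S. a j)"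

definition sigma_Z :: "(real^'n) set \<Rightarrow> nat \<Rightarrow> real" where
  "sigma_Z Z i = esym CARD('n) i (\<lambda>j. 1 / succ_min (diff_body Z) j)"

end

theory Submission
  imports Defs
begin

text \<open>Up to a lattice translation, \<open>Z\<close> is the sum of the segments \<open>[0, v]\<close> over a list \<open>vs\<close> of lattice
  vectors.  For a linearly independent set \<open>U\<close> of lattice vectors, count the lattice points of
  \<open>k Z + span U\<close> modulo the lattice generated by \<open>U\<close>.  Adding a segment \<open>[0, v]\<close> with
  \<open>v \<notin> span U\<close> increases this count by the one belonging to \<open>U \<union> {v}\<close>, so it is a polynomial in
  \<open>k\<close>, whose derivative is the sum of the polynomials belonging to \<open>U \<union> {v}\<close>.  Hence \<open>i! g\<^sub>i\<close> is the
  sum, over all independent \<open>i\<close>-tuples of generators, of the index of the lattice they generate in the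
  lattice points of their span.

  Let \<open>a\<^sub>1, \<dots>, a\<^sub>n\<close> be independent lattice vectors attaining the successive minima of \<open>DZ\<close>.
  The index of an \<open>i\<close>-tuple is at most the absolute determinant of the tuple completed by suitable
  \<open>a\<^sub>j\<close>.  Each such \<open>a\<^sub>j\<close> is a combination of the generators with coefficients bounded by
  its successive minimum, and expanding the determinant multilinearly bounds it by
  \<open>\<lambda>\<^sub>i\<^sub>+\<^sub>1 \<cdots> \<lambda>\<^sub>n\<close> times the sum of the determinants of all completions by generators.  Summing over the
  tuples gives \<open>i! g\<^sub>i \<le> \<lambda>\<^sub>i\<^sub>+\<^sub>1 \<cdots> \<lambda>\<^sub>n n! g\<^sub>n\<close>, and \<open>g\<^sub>n \<le> vol Z\<close>.  The second inequality then
  follows from Minkowski's second theorem for \<open>DZ\<close>.\<close>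

section \<open>Transversals of lattices\<close>

text \<open>A packing modulo \<open>G\<close> is no larger than a covering: cut \<open>A\<close>
  along the translates \<open>g + B\<close> and move each piece back into \<open>B\<close>. The
  moved pieces are disjoint because distinct points of \<open>A\<close> are incongruent modulo
  \<open>G\<close>.\<close>

lemma transversal_emeasure_le:
  fixes A B G :: "'a::euclidean_space set"
  assumes G: "countable G" and A: "A \<in> sets lebesgue" and B: "B \<in> sets lebesgue"
    and inj: "\<And>x y. x \<in> A \<Longrightarrow> y \<in> A \<Longrightarrow> x - y \<in> G \<Longrightarrow> x = y"
    and diff: "\<And>g h. g \<in> G \<Longrightarrow> h \<in> G \<Longrightarrow> g - h \<in> G"
    and cover: "\<And>x. x \<in> A \<Longrightarrow> \<exists>g\<in>G. x - g \<in> B"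
  shows "emeasure lebesgue A \<le> emeasure lebesgue B"
proof -
  define S where "S g = A \<inter> (\<lambda>x. g + x) ` B" for g
  define R where "R g = (\<lambda>x. - g + x) ` S g" for g
  define I where "I = to_nat_on G ` G"
  define gn where "gn = from_nat_into G"
  have gn: "gn k \<in> G" if "k \<in> I" for k
    using that G unfolding I_def gn_def by auto
  have inj_gn: "gn k \<noteq> gn l" if "k \<in> I" "l \<in> I" "k \<noteq> l" for k l
    using that unfolding I_def gn_def using G by auto
  have Sm: "S g \<in> sets lebesgue" for g
    unfolding S_def using A B lebesgue_sets_translation by blast
  have Rm: "R g \<in> sets lebesgue" for g
    unfolding R_def using Sm lebesgue_sets_translation by blast
  have eq: "emeasure lebesgue (R g) = emeasure lebesgue (S g)" for g
    unfolding R_def using emeasure_lebesgue_affine[of 1 "-g" "S g"] by simp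
  \<comment> \<open>Numbering the pieces by all naturals, with empty pieces outside
    \<open>I\<close>, treats finite and infinite \<open>G\<close> alike.\<close>
  define S' where "S' k = (if k \<in> I then S (gn k) else {})" for k
  define R' where "R' k = (if k \<in> I then R (gn k) else {})" for k
  have "A \<subseteq> (\<Union>k. S' k)"
  proof
    fix x assume x: "x \<in> A"
    then obtain g where g: "g \<in> G" "x - g \<in> B" using cover by blast
    have "x = g + (x - g)" by simp
    hence "x \<in> S g" unfolding S_def using x g by blast
    moreover have "gn (to_nat_on G g) = g" "to_nat_on G g \<in> I"
      using g G unfolding gn_def I_def by auto
    ultimately show "x \<in> (\<Union>k. S' k)" unfolding S'_def by force
  qed
  hence "emeasure lebesgue A \<le> emeasure lebesgue (\<Union>k. S' k)"
    by (intro emeasure_mono) (auto simp: S'_def Sm)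
  \<comment> \<open>Translates of \<open>B\<close> may overlap, so the pieces of \<open>A\<close>
    are only subadditive; full additivity comes after moving them into \<open>B\<close>.\<close>
  also have "\<dots> \<le> (\<Sum>k. emeasure lebesgue (S' k))"
    by (rule emeasure_subadditive_countably) (auto simp: S'_def Sm)
  also have "\<dots> = (\<Sum>k. emeasure lebesgue (R' k))"
    by (simp add: S'_def R'_def eq if_distrib cong: if_cong)
  also have "\<dots> = emeasure lebesgue (\<Union>k. R' k)"
  proof (rule suminf_emeasure)
    show "range R' \<subseteq> sets lebesgue" by (auto simp: R'_def Rm)
    show "disjoint_family R'"
    proof (unfold disjoint_family_on_def, intro ballI impI)
      fix k l :: nat assume kl: "k \<noteq> l"
      show "R' k \<inter> R' l = {}"
      proof (rule ccontr)
        assume "R' k \<inter> R' l \<noteq> {}"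
        then obtain y where y: "y \<in> R' k" "y \<in> R' l" by blast
        hence I: "k \<in> I" "l \<in> I" by (auto simp: R'_def split: if_splits)
        with y have "gn k + y \<in> A" "gn l + y \<in> A"
          by (auto simp: R'_def R_def S_def)
        moreover have "(gn k + y) - (gn l + y) \<in> G" using diff[OF gn gn, OF I] by simp
        ultimately have "gn k + y = gn l + y" by (rule inj)
        thus False using inj_gn[OF I kl] by simp
      qed
    qed
  qed
  also have "\<dots> \<le> emeasure lebesgue B"
  proof (rule emeasure_mono[OF _ B])
    show "(\<Union>k. R' k) \<subseteq> B" by (auto simp: R'_def R_def S_def split: if_splits)
  qed
  finally show ?thesis .
qed

lemma transversal_measure_le:
  fixes A B G :: "'a::euclidean_space set"
  assumes "countable G" "A \<in> lmeasurable" "B \<in> lmeasurable"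
    and "\<And>x y. x \<in> A \<Longrightarrow> y \<in> A \<Longrightarrow> x - y \<in> G \<Longrightarrow> x = y"
    and "\<And>g h. g \<in> G \<Longrightarrow> h \<in> G \<Longrightarrow> g - h \<in> G"
    and "\<And>x. x \<in> A \<Longrightarrow> \<exists>g\<in>G. x - g \<in> B"
  shows "measure lebesgue A \<le> measure lebesgue B"
proof -
  have "emeasure lebesgue A \<le> emeasure lebesgue B"
    using assms by (intro transversal_emeasure_le[of G]) (auto dest: fmeasurableD)
  thus ?thesis using assms(2,3) by (simp add: emeasure_eq_measure2)
qed

section \<open>Integer points and their fundamental cell\<close>

lemma zero_mem_lattice_points [simp]: "0 \<in> lattice_points"
  and lattice_points_add: "x \<in> lattice_points \<Longrightarrow> y \<in> lattice_points \<Longrightarrow> x + y \<in> lattice_points"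
  and lattice_points_diff: "x \<in> lattice_points \<Longrightarrow> y \<in> lattice_points \<Longrightarrow> x - y \<in> lattice_points"
  and lattice_points_scale: "c \<in> \<int> \<Longrightarrow> x \<in> lattice_points \<Longrightarrow> c *\<^sub>R x \<in> lattice_points"
  by (auto simp: lattice_points_def)

lemma lattice_points_sum: "(\<And>i. i \<in> I \<Longrightarrow> f i \<in> lattice_points) \<Longrightarrow> sum f I \<in> lattice_points"
  by (induction I rule: infinite_finite_induct) (auto intro: lattice_points_add)

lemma finite_bounded_lattice_points:
  fixes S :: "(real^'n) set"
  assumes "bounded S"
  shows "finite (S \<inter> lattice_points)"
proof -
  obtain B where B: "\<And>x. x \<in> S \<Longrightarrow> norm x \<le> B" using assms bounded_iff by blast
  let ?P = "\<Pi>\<^sub>E i\<in>(UNIV::'n set). real_of_int ` {-\<lceil>B\<rceil>..\<lceil>B\<rceil>}"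
  have "S \<inter> lattice_points \<subseteq> (\<lambda>f. \<chi> i. f i) ` ?P"
  proof
    fix x assume x: "x \<in> S \<inter> lattice_points"
    have "x $ i \<in> real_of_int ` {-\<lceil>B\<rceil>..\<lceil>B\<rceil>}" for i
    proof -
      obtain m where m: "x $ i = real_of_int m" using x by (auto simp: lattice_points_def elim: Ints_cases)
      have "\<bar>x $ i\<bar> \<le> B" using B x component_le_norm_cart[of x i] by fastforce
      hence "real_of_int \<bar>m\<bar> \<le> real_of_int \<lceil>B\<rceil>" using m by linarith
      hence "m \<in> {-\<lceil>B\<rceil>..\<lceil>B\<rceil>}" by (simp add: abs_le_iff)
      thus ?thesis using m by blast
    qed
    hence "($) x \<in> ?P" by auto
    moreover have "x = (\<chi> i. x $ i)" by simp
    ultimately show "x \<in> (\<lambda>f. \<chi> i. f i) ` ?P" by blast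
  qed
  moreover have "finite ?P" by (intro finite_PiE) auto
  ultimately show ?thesis by (meson finite_imageI finite_subset)
qed

lemma countable_lattice_points: "countable (lattice_points :: (real^'n) set)"
proof -
  have "lattice_points = (\<Union>k::nat. cball 0 (real k) \<inter> (lattice_points :: (real^'n) set))"
    by (auto simp: real_arch_simple)
  also have "countable \<dots>"
    by (intro countable_UN) (auto intro: countable_finite finite_bounded_lattice_points)
  finally show ?thesis .
qed

text \<open>Half open, so that it is at once a packing and a covering modulo the lattice.\<close>

definition unit_cube :: "(real^'n) set" where
  "unit_cube = {x. \<forall>i. 0 \<le> x $ i \<and> x $ i < 1}"

lemma unit_cube_cover:
  fixes x :: "real^'n"
  shows "\<exists>g\<in>lattice_points. x - g \<in> unit_cube"
proof
  let ?g = "(\<chi> i. of_int \<lfloor>x $ i\<rfloor>) :: real^'n"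
  show "?g \<in> lattice_points" by (simp add: lattice_points_def)
  show "x - ?g \<in> unit_cube" by (auto simp: unit_cube_def) linarith
qed

lemma unit_cube_inj:
  assumes "x \<in> unit_cube" "y \<in> unit_cube" "x - y \<in> lattice_points"
  shows "x = y"
proof (unfold vec_eq_iff, rule allI)
  fix i
  obtain m where m: "x $ i - y $ i = of_int m"
    using assms(3) by (auto simp: lattice_points_def elim: Ints_cases)
  have "\<bar>of_int m :: real\<bar> < 1" using assms(1,2) m unfolding unit_cube_def
    by (smt (verit) mem_Collect_eq)
  hence "m = 0" by linarith
  thus "x $ i = y $ i" using m by simp
qed

lemma unit_cube_lmeasurable: "(unit_cube :: (real^'n) set) \<in> lmeasurable"
  and measure_unit_cube: "measure lebesgue (unit_cube :: (real^'n) set) = 1"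
proof -
  have eq: "unit_cube = (\<Inter>i. {x::real^'n. 0 \<le> x $ i} \<inter> {x. x $ i < 1})"
    by (auto simp: unit_cube_def)
  have b: "(unit_cube :: (real^'n) set) \<in> sets borel"
    unfolding eq by measurable
  have s: "unit_cube \<subseteq> cbox (0::real^'n) 1" "box (0::real^'n) 1 \<subseteq> unit_cube"
    by (auto simp: unit_cube_def mem_box_cart less_imp_le)
  show m: "(unit_cube :: (real^'n) set) \<in> lmeasurable"
    by (rule bounded_set_imp_lmeasurable) (use s b in \<open>auto intro: bounded_subset[OF bounded_cbox]\<close>)
  have "measure lebesgue (unit_cube :: (real^'n) set) \<le> measure lebesgue (cbox (0::real^'n) 1)"
    by (rule measure_mono_fmeasurable) (use s m in \<open>auto dest: fmeasurableD\<close>)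
  moreover have "measure lebesgue (box (0::real^'n) 1) \<le> measure lebesgue (unit_cube :: (real^'n) set)"
    by (rule measure_mono_fmeasurable) (use s m in auto)
  moreover have "measure lebesgue (cbox (0::real^'n) 1) = 1"
    using content_cbox_cart[of "0::real^'n" 1] by (simp add: interval_ne_empty_cart)
  moreover have "measure lebesgue (box (0::real^'n) 1) = measure lebesgue (cbox (0::real^'n) 1)"
    by (simp add: measure_lborel_cbox_eq measure_lborel_box_eq)
  ultimately show "measure lebesgue (unit_cube :: (real^'n) set) = 1" by linarith
qed

section \<open>Volume of linear images\<close>

lemma det_shear:
  fixes m n :: "'n::finite"
  assumes "m \<noteq> n"
  shows "det (matrix (\<lambda>v::real^'n. \<chi> i. if i = m then v $ m + v $ n else v $ i)) = 1"
proof -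
  have "matrix (\<lambda>v::real^'n. \<chi> i. if i = m then v $ m + v $ n else v $ i) =
      (\<chi> k. if k = m then row m (mat 1) + 1 *s row n (mat 1) else row k (mat 1))"
    by (auto simp: matrix_def vec_eq_iff row_def mat_def axis_def)
  thus ?thesis using det_row_operation[OF assms, of "mat 1 :: real^'n^'n" 1] by simp
qed

lemma measure_shear_cbox:
  fixes a b :: "real^'n"
  assumes mn: "m \<noteq> n"
  shows "measure lebesgue ((\<lambda>v. \<chi> i. if i = m then v $ m + v $ n else v $ i) ` cbox a b)
      = measure lebesgue (cbox a b)" (is "measure _ (?h ` _) = _")
proof (cases "cbox a b = {}")
  case False
  \<comment> \<open>The volume formula for shears asks for a nonnegative lower bound in coordinate
    \<open>n\<close>. Translating by \<open>w\<close> makes that bound \<open>0\<close>, and by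
    linearity of the shear the image is merely translated as well.\<close>
  define w :: "real^'n" where "w = axis n (- (a $ n))"
  have lin: "linear ?h" by (rule linearI) (auto simp: algebra_simps vec_eq_iff)
  have "measure lebesgue (?h ` cbox a b) = measure lebesgue ((+) (?h w) ` ?h ` cbox a b)"
    by (rule measure_translation[symmetric])
  also have "(+) (?h w) ` ?h ` cbox a b = ?h ` ((+) w ` cbox a b)"
    by (simp add: image_image linear_add[OF lin])
  also have "\<dots> = ?h ` cbox (w + a) (w + b)" by (simp add: cbox_translation)
  also have "measure lebesgue \<dots> = measure lebesgue (cbox (w + a) (w + b))"
  proof (rule measure_shear_interval[OF mn])
    show "cbox (w + a) (w + b) \<noteq> {}" using False by (simp add: cbox_translation)
    show "0 \<le> (w + a) $ n" by (simp add: w_def)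
  qed
  also have "\<dots> = measure lebesgue ((+) w ` cbox a b)" by (simp add: cbox_translation)
  also have "\<dots> = measure lebesgue (cbox a b)" by (rule measure_translation)
  finally show ?thesis .
qed simp

text \<open>The corresponding results of the library require the index type to be well-ordered.\<close>

proposition
  fixes f :: "real^'n \<Rightarrow> real^'n"
  assumes "linear f" "S \<in> lmeasurable"
  shows lmeasurable_linear_image: "f ` S \<in> lmeasurable"
    and measure_lebesgue_linear_image: "measure lebesgue (f ` S) = \<bar>det (matrix f)\<bar> * measure lebesgue S"
proof -
  define P where "P g \<longleftrightarrow> (\<forall>S\<in>lmeasurable. g ` S \<in> lmeasurable \<and>
      measure lebesgue (g ` S) = \<bar>det (matrix g)\<bar> * measure lebesgue S)" for g :: "real^'n \<Rightarrow> real^'n"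
  \<comment> \<open>This serves the coordinate swaps and the shears: preserving volumes of boxes
    forces preserving all volumes, which matches a determinant of absolute value
    \<open>1\<close>.\<close>
  have suff: "P g" if lin: "linear g" and "\<bar>det (matrix g)\<bar> = 1"
    and box: "\<And>a b. measure lebesgue (g ` cbox a b) = measure lebesgue (cbox a b)" for g
    
  proof -
    have "\<And>a b. measure lebesgue (g ` cbox a b) = 1 * measure lebesgue (cbox a b)"
      by (simp add: box)
    note sc = measure_linear_sufficient[OF lin _ this]
    have "g ` S \<in> lmeasurable \<and> measure lebesgue (g ` S) = 1 * measure lebesgue S"
      if "S \<in> lmeasurable" for S
      by (rule conjI[OF conjunct1[OF sc[OF that]] conjunct2[OF sc[OF that], symmetric]])
    thus "P g" unfolding P_def \<open>\<bar>det (matrix g)\<bar> = 1\<close> by blast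
  qed
  have "P f"
  proof (rule induct_linear_elementary[OF \<open>linear f\<close>])
    fix g h :: "real^'n \<Rightarrow> real^'n"
    assume "linear g" "linear h" "P g" "P h"
    moreover have "det (matrix (g \<circ> h)) = det (matrix g) * det (matrix h)"
      using \<open>linear g\<close> \<open>linear h\<close> by (simp only: matrix_compose det_mul)
    moreover have "(g \<circ> h) ` S = g ` (h ` S)" for S by auto
    ultimately show "P (g \<circ> h)" unfolding P_def
      by (simp add: abs_mult)
  next
    fix g :: "real^'n \<Rightarrow> real^'n" and i
    assume g: "linear g" and z: "\<And>x. g x $ i = 0"
    have "\<not> surj g"
    proof
      assume "surj g"
      then obtain x where "g x = axis i 1" by (metis surjD)
      thus False using z[of x] by simp
    qed
    hence ni: "\<not> inj g" using g linear_injective_imp_surjective by blast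
    have neg: "negligible (g ` S)" for S using negligible_linear_singular_image[OF g ni] .
    show "P g" unfolding P_def
    proof (intro ballI conjI)
      fix S :: "(real^'n) set"
      show "g ` S \<in> lmeasurable" using neg[of S] by (simp add: negligible_iff_measure)
      have "measure lebesgue (g ` S) = 0" using neg negligible_imp_measure0 by blast
      thus "measure lebesgue (g ` S) = \<bar>det (matrix g)\<bar> * measure lebesgue S"
        using ni det_nz_iff_inj[OF g] by simp
    qed
  next
    fix c :: "'n \<Rightarrow> real"
    have "det (matrix (\<lambda>x::real^'n. \<chi> i. c i * x $ i)) = prod c UNIV"
      by (subst det_diagonal) (auto simp: matrix_def axis_def)
    thus "P (\<lambda>x. \<chi> i. c i * x $ i)"
      unfolding P_def by (simp add: measurable_stretch measure_stretch)
  next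
    fix m n :: 'n
    assume mn: "m \<noteq> n"
    let ?t = "Transposition.transpose m n"
    let ?h = "\<lambda>x::real^'n. \<chi> i. x $ ?t i"
    show "P ?h"
    proof (rule suff)
      show "linear ?h" by (rule linearI) (auto simp: vec_eq_iff)
      have "matrix ?h = (\<chi> i. (mat 1 :: real^'n^'n) $ ?t i)"
        by (auto simp: matrix_def vec_eq_iff mat_def axis_def)
      thus "\<bar>det (matrix ?h)\<bar> = 1"
        by (simp add: det_permute_rows permutes_swap_id sign_swap_id abs_mult)
      fix a b :: "real^'n"
      have eq: "?h ` cbox a b = cbox (?h a) (?h b)"
      proof (intro equalityI subsetI)
        fix y assume y: "y \<in> cbox (?h a) (?h b)"
        have "a $ i \<le> y $ ?t i \<and> y $ ?t i \<le> b $ i" for i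
        proof -
          have "?h a $ ?t i \<le> y $ ?t i \<and> y $ ?t i \<le> ?h b $ ?t i"
            using y unfolding mem_box_cart by blast
          thus ?thesis by simp
        qed
        hence "?h y \<in> cbox a b" by (simp add: mem_box_cart)
        moreover have "y = ?h (?h y)" by (simp add: vec_eq_iff)
        ultimately show "y \<in> ?h ` cbox a b" by blast
      qed (auto simp: mem_box_cart)
      show "measure lebesgue (?h ` cbox a b) = measure lebesgue (cbox a b)"
      proof (cases "cbox a b = {}")
        case False
        hence "cbox (?h a) (?h b) \<noteq> {}" unfolding eq[symmetric] by simp
        hence "measure lebesgue (cbox (?h a) (?h b)) = (\<Prod>i\<in>UNIV. b $ ?t i - a $ ?t i)"
          by (simp add: content_cbox_cart)
        also have "\<dots> = (\<Prod>i\<in>UNIV. b $ i - a $ i)"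
          by (rule prod.reindex_bij_betw[of ?t UNIV UNIV "\<lambda>i. b $ i - a $ i"]) simp
        also have "\<dots> = measure lebesgue (cbox a b)" using False by (simp add: content_cbox_cart)
        finally show ?thesis unfolding eq .
      qed simp
    qed
  next
    fix m n :: 'n
    assume mn: "m \<noteq> n"
    show "P (\<lambda>x. \<chi> i. if i = m then x $ m + x $ n else x $ i)"
      by (rule suff) (auto simp: det_shear[OF mn] measure_shear_cbox[OF mn]
          algebra_simps vec_eq_iff intro!: linearI)
  qed
  thus "f ` S \<in> lmeasurable" "measure lebesgue (f ` S) = \<bar>det (matrix f)\<bar> * measure lebesgue S"
    using assms(2) unfolding P_def by auto
qed

section \<open>Lattice points modulo a sublattice\<close>

definition int_span :: "(real^'n) set \<Rightarrow> (real^'n) set" where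
  "int_span U = range (\<lambda>c. \<Sum>u\<in>U. of_int (c u) *\<^sub>R u)"

text \<open>The Minkowski sum \<open>X + span U\<close>, that is, \<open>X\<close> seen modulo
  \<open>span U\<close>.\<close>

definition span_sat :: "(real^'n) set \<Rightarrow> (real^'n) set \<Rightarrow> (real^'n) set" where
  "span_sat U X = {z. \<exists>x\<in>X. z - x \<in> span U}"

definition int_coset :: "(real^'n) set \<Rightarrow> real^'n \<Rightarrow> (real^'n) set" where
  "int_coset U z = {y. y - z \<in> int_span U}"

text \<open>Two cases matter at the ends of the argument: for \<open>X = {0}\<close> the cardinality
  is the index of \<open>int_span U\<close> in the lattice points of \<open>span U\<close>, and for
  \<open>U = {}\<close> it is the number of lattice points of \<open>X\<close>.\<close>

definition lattice_classes :: "(real^'n) set \<Rightarrow> (real^'n) set \<Rightarrow> (real^'n) set set" where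
  "lattice_classes U X = int_coset U ` (lattice_points \<inter> span_sat U X)"

definition seg_sum :: "(real^'n) set \<Rightarrow> real \<Rightarrow> real^'n \<Rightarrow> (real^'n) set" where
  "seg_sum X k v = {x + t *\<^sub>R v | x t. x \<in> X \<and> 0 \<le> t \<and> t \<le> k}"

text \<open>As the image of a product under a continuous linear map, the set inherits compactness
  and convexity from \<open>X\<close>.\<close>

lemma sum_segment_image:
  "{x + t *\<^sub>R v | x t. x \<in> X \<and> a \<le> t \<and> t \<le> b} = (\<lambda>p. fst p + snd p *\<^sub>R v) ` (X \<times> {a..b})"
proof (intro set_eqI iffI)
  fix z assume "z \<in> {x + t *\<^sub>R v | x t. x \<in> X \<and> a \<le> t \<and> t \<le> b}"
  then obtain x t where "z = (\<lambda>p. fst p + snd p *\<^sub>R v) (x, t)" "(x, t) \<in> X \<times> {a..b}" by auto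
  thus "z \<in> (\<lambda>p. fst p + snd p *\<^sub>R v) ` (X \<times> {a..b})" by (rule image_eqI)
next
  fix z assume "z \<in> (\<lambda>p. fst p + snd p *\<^sub>R v) ` (X \<times> {a..b})"
  then obtain x t where "z = x + t *\<^sub>R v" "x \<in> X \<and> a \<le> t \<and> t \<le> b" by auto
  thus "z \<in> {x + t *\<^sub>R v | x t. x \<in> X \<and> a \<le> t \<and> t \<le> b}" by blast
qed

lemma
  fixes v :: "real^'n"
  shows compact_sum_segment: "compact X \<Longrightarrow> compact {x + t *\<^sub>R v | x t. x \<in> X \<and> a \<le> t \<and> t \<le> b}"
    and convex_sum_segment: "convex X \<Longrightarrow> convex {x + t *\<^sub>R v | x t. x \<in> X \<and> a \<le> t \<and> t \<le> b}"
proof -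
  show "compact {x + t *\<^sub>R v | x t. x \<in> X \<and> a \<le> t \<and> t \<le> b}" if "compact X"
    unfolding sum_segment_image
    by (intro compact_continuous_image continuous_intros compact_Times that compact_Icc)
  show "convex {x + t *\<^sub>R v | x t. x \<in> X \<and> a \<le> t \<and> t \<le> b}" if "convex X"
    unfolding sum_segment_image
    by (intro convex_linear_image convex_Times that convex_real_interval)
      (auto intro!: linearI simp: algebra_simps)
qed

lemma compact_seg_sum: "compact X \<Longrightarrow> compact (seg_sum X k v)"
  and convex_seg_sum: "convex X \<Longrightarrow> convex (seg_sum X k v)"
  unfolding seg_sum_def by (rule compact_sum_segment, assumption) (rule convex_sum_segment)

section \<open>Generated lattices and their cosets\<close>

lemma int_spanI: "(\<Sum>u\<in>U. of_int (c u) *\<^sub>R u) \<in> int_span U"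
  unfolding int_span_def by blast

lemma int_span_zero [simp]: "0 \<in> int_span U"
  unfolding int_span_def by (rule range_eqI[of _ _ "\<lambda>_. 0"]) simp

lemma int_span_diff:
  assumes "x \<in> int_span U" "y \<in> int_span U"
  shows "x - y \<in> int_span U"
proof -
  obtain c d where "x = (\<Sum>u\<in>U. of_int (c u) *\<^sub>R u)" "y = (\<Sum>u\<in>U. of_int (d u) *\<^sub>R u)"
    using assms by (auto simp: int_span_def)
  hence "x - y = (\<Sum>u\<in>U. of_int (c u - d u) *\<^sub>R u)"
    by (simp add: sum_subtractf scaleR_left_diff_distrib)
  thus ?thesis using int_spanI[of "\<lambda>u. c u - d u" U] by simp
qed

lemma int_span_uminus: "x \<in> int_span U \<Longrightarrow> - x \<in> int_span U"
  using int_span_diff[of 0 U x] by simp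

lemma int_span_add: "x \<in> int_span U \<Longrightarrow> y \<in> int_span U \<Longrightarrow> x + y \<in> int_span U"
  using int_span_diff[of x U "- y"] int_span_uminus[of y U] by simp

lemma int_span_subset_span: "int_span U \<subseteq> span U"
  unfolding int_span_def by (auto intro: span_sum span_scale span_base)

lemma int_span_subset_lattice: "U \<subseteq> lattice_points \<Longrightarrow> int_span U \<subseteq> lattice_points"
  unfolding int_span_def by (auto intro!: lattice_points_sum lattice_points_scale)

lemma int_span_empty [simp]: "int_span {} = {0}"
  by (simp add: int_span_def)

lemma int_span_insert:
  assumes "finite U" "v \<notin> U"
  shows "x \<in> int_span (insert v U) \<longleftrightarrow> (\<exists>g\<in>int_span U. \<exists>m. x = g + of_int m *\<^sub>R v)"
proof
  assume "x \<in> int_span (insert v U)"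
  then obtain c where "x = (\<Sum>u\<in>insert v U. of_int (c u) *\<^sub>R u)" by (auto simp: int_span_def)
  hence "x = (\<Sum>u\<in>U. of_int (c u) *\<^sub>R u) + of_int (c v) *\<^sub>R v"
    using assms by (simp add: add.commute)
  moreover have "(\<Sum>u\<in>U. of_int (c u) *\<^sub>R u) \<in> int_span U" unfolding int_span_def by blast
  ultimately show "\<exists>g\<in>int_span U. \<exists>m. x = g + of_int m *\<^sub>R v" by blast
next
  assume "\<exists>g\<in>int_span U. \<exists>m. x = g + of_int m *\<^sub>R v"
  then obtain c m where x: "x = (\<Sum>u\<in>U. of_int (c u) *\<^sub>R u) + of_int m *\<^sub>R v"
    by (auto simp: int_span_def)
  have "(\<Sum>u\<in>U. of_int (c u) *\<^sub>R u) = (\<Sum>u\<in>U. of_int ((c(v := m)) u) *\<^sub>R u)"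
    using assms by (intro sum.cong) auto
  hence "x = (\<Sum>u\<in>insert v U. of_int ((c(v := m)) u) *\<^sub>R u)"
    using assms x by (simp add: add.commute)
  thus "x \<in> int_span (insert v U)" unfolding int_span_def by blast
qed

lemma int_coset_eq_iff: "int_coset U x = int_coset U y \<longleftrightarrow> x - y \<in> int_span U"
proof
  assume "int_coset U x = int_coset U y"
  moreover have "x \<in> int_coset U x" by (simp add: int_coset_def)
  ultimately show "x - y \<in> int_span U" by (simp add: int_coset_def)
next
  assume xy: "x - y \<in> int_span U"
  have "z - x \<in> int_span U \<longleftrightarrow> z - y \<in> int_span U" for z
    using int_span_add[OF _ xy, of "z - x"] int_span_diff[OF _ xy, of "z - y"] by auto
  thus "int_coset U x = int_coset U y" by (auto simp: int_coset_def)
qed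

lemma span_sat_translate:
  assumes "x \<in> span_sat U X" "y - x \<in> span U"
  shows "y \<in> span_sat U X"
proof -
  obtain w where "w \<in> X" "x - w \<in> span U" using assms(1) by (auto simp: span_sat_def)
  moreover have "y - w = (y - x) + (x - w)" by simp
  ultimately show ?thesis using assms(2) span_add unfolding span_sat_def by (metis (mono_tags) mem_Collect_eq)
qed

lemma span_sat_empty [simp]: "span_sat {} X = X"
  by (auto simp: span_sat_def)

text \<open>Subtracting the integer parts of the coordinates along \<open>U\<close> moves every
  class to a representative within a fixed distance of \<open>X\<close>, hence into a ball.\<close>

lemma finite_lattice_classes:
  fixes X :: "(real^'n) set"
  assumes U: "finite U" "U \<subseteq> lattice_points" and X: "bounded X"
  shows "finite (lattice_classes U X)"
proof -
  obtain B where B: "\<And>x. x \<in> X \<Longrightarrow> norm x \<le> B" using X bounded_iff by blast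
  let ?F = "cball 0 (B + (\<Sum>u\<in>U. norm u)) \<inter> (lattice_points :: (real^'n) set)"
  have "lattice_classes U X \<subseteq> int_coset U ` ?F"
    unfolding lattice_classes_def
  proof (rule image_subsetI)
    fix z assume z: "z \<in> lattice_points \<inter> span_sat U X"
    then obtain x where x: "x \<in> X" "z - x \<in> span U" by (auto simp: span_sat_def)
    then obtain c where c: "z - x = (\<Sum>u\<in>U. c u *\<^sub>R u)"
      using span_finite[OF U(1)] by auto
    define g where "g = (\<Sum>u\<in>U. of_int \<lfloor>c u\<rfloor> *\<^sub>R u)"
    have g: "g \<in> int_span U" unfolding g_def by (rule int_spanI)
    have "z - g = x + (\<Sum>u\<in>U. frac (c u) *\<^sub>R u)"
      using c by (simp add: g_def frac_def scaleR_left_diff_distrib sum_subtractf algebra_simps)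
    hence "norm (z - g) \<le> norm x + norm (\<Sum>u\<in>U. frac (c u) *\<^sub>R u)"
      by (simp add: norm_triangle_ineq)
    also have "\<dots> \<le> norm x + (\<Sum>u\<in>U. norm (frac (c u) *\<^sub>R u))"
      by (intro add_left_mono norm_sum)
    also have "\<dots> \<le> B + (\<Sum>u\<in>U. norm u)"
      by (intro add_mono B x sum_mono) (auto simp: mult_left_le_one_le frac_ge_0 less_imp_le[OF frac_lt_1])
    finally have "z - g \<in> ?F"
      using z g int_span_subset_lattice[OF U(2)] by (auto intro: lattice_points_diff)
    moreover have "int_coset U z = int_coset U (z - g)" using g by (simp add: int_coset_eq_iff)
    ultimately show "int_coset U z \<in> int_coset U ` ?F" by blast
  qed
  moreover have "finite ?F" by (rule finite_bounded_lattice_points) simp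
  ultimately show ?thesis by (meson finite_imageI finite_subset)
qed

text \<open>Used to compare cosets of two different lattices on one common set of points.\<close>

lemma card_image_eq_if_same_fibres:
  assumes "\<And>x y. x \<in> A \<Longrightarrow> y \<in> A \<Longrightarrow> f x = f y \<longleftrightarrow> g x = g y"
  shows "card (f ` A) = card (g ` A)"
proof -
  define h where "h b = g (SOME x. x \<in> A \<and> f x = b)" for b
  have h: "h (f x) = g x" if "x \<in> A" for x
  proof -
    have "(SOME y. y \<in> A \<and> f y = f x) \<in> A \<and> f (SOME y. y \<in> A \<and> f y = f x) = f x"
      by (rule someI[of _ x]) (use that in simp)
    thus ?thesis using assms that unfolding h_def by blast
  qed
  have "bij_betw h (f ` A) (g ` A)"
    unfolding bij_betw_def
  proof
    show "inj_on h (f ` A)" using assms h by (auto simp: inj_on_def)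
    show "h ` f ` A = g ` A" using h by (auto simp: image_iff)
  qed
  thus ?thesis by (rule bij_betw_same_card)
qed

section \<open>Adding a segment to a convex body modulo a subspace\<close>

lemma convex_scalar_fibre:
  assumes X: "convex X" and s: "z + s *\<^sub>R v \<in> span_sat U X" and t: "z + t *\<^sub>R v \<in> span_sat U X"
    and r: "s \<le> r" "r \<le> t"
  shows "z + r *\<^sub>R v \<in> span_sat U X"
proof (cases "s = t")
  case True
  thus ?thesis using s r by simp
next
  case False
  hence st: "s < t" using r by simp
  define a where "a = (r - s) / (t - s)"
  have a: "0 \<le> a" "a \<le> 1" using r st by (auto simp: a_def)
  have ra: "r = (1 - a) * s + a * t" 
  proof -
    have "(1 - a) * s + a * t = s + a * (t - s)" by (simp add: algebra_simps)
    also have "\<dots> = r" using st by (simp add: a_def)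
    finally show ?thesis ..
  qed
  obtain x y where xy: "x \<in> X" "y \<in> X" "z + s *\<^sub>R v - x \<in> span U" "z + t *\<^sub>R v - y \<in> span U"
    using s t by (auto simp: span_sat_def)
  have "(1 - a) *\<^sub>R x + a *\<^sub>R y \<in> X" using X xy a by (simp add: convexD_alt)
  moreover have "z + r *\<^sub>R v - ((1 - a) *\<^sub>R x + a *\<^sub>R y) =
      (1 - a) *\<^sub>R (z + s *\<^sub>R v - x) + a *\<^sub>R (z + t *\<^sub>R v - y)"
    unfolding ra by (simp add: algebra_simps)
  hence "z + r *\<^sub>R v - ((1 - a) *\<^sub>R x + a *\<^sub>R y) \<in> span U"
    using xy span_add span_scale by metis
  ultimately show ?thesis unfolding span_sat_def by blast
qed

text \<open>The parameters along the line form a closed set, since a compact set plus a subspace is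
  closed. They are bounded above because \<open>v\<close> has a nonzero component orthogonal to
  \<open>span U\<close>.\<close>

lemma last_scalar_in_fibre:
  fixes X :: "(real^'n) set"
  assumes X: "compact X" and v: "v \<notin> span U" and ne: "z + s0 *\<^sub>R v \<in> span_sat U X"
  obtains q where "z + q *\<^sub>R v \<in> span_sat U X" "\<And>s. z + s *\<^sub>R v \<in> span_sat U X \<Longrightarrow> s \<le> q"
proof -
  let ?I = "{s. z + s *\<^sub>R v \<in> span_sat U X}"
  have "closed (\<Union>x\<in>X. \<Union>y\<in>span U. {x + y})"
    by (rule compact_closed_sums[OF X closed_subspace[OF subspace_span]])
  moreover have "span_sat U X = (\<Union>x\<in>X. \<Union>y\<in>span U. {x + y})"
  proof (intro equalityI subsetI)
    fix z assume "z \<in> span_sat U X"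
    then obtain x where "x \<in> X" "z - x \<in> span U" by (auto simp: span_sat_def)
    thus "z \<in> (\<Union>x\<in>X. \<Union>y\<in>span U. {x + y})" by (force intro: bexI[of _ "z - x"])
  qed (auto simp: span_sat_def intro!: bexI)
  ultimately have "closed (span_sat U X)" by simp
  moreover have "?I = (\<lambda>s. z + s *\<^sub>R v) -` span_sat U X" by auto
  ultimately have cl: "closed ?I"
    by (auto intro!: closed_vimage continuous_intros)
  obtain y w where yw: "y \<in> span U" "\<And>u. u \<in> span U \<Longrightarrow> orthogonal w u" "v = y + w"
    using orthogonal_subspace_decomp_exists by blast
  have "w \<noteq> 0" using v yw by auto
  hence wv: "w \<bullet> v > 0" using yw by (simp add: inner_add_right orthogonal_def)
  obtain B where B: "\<And>x. x \<in> X \<Longrightarrow> norm x \<le> B"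
    using compact_imp_bounded[OF X] bounded_iff by blast
  \<comment> \<open>Pairing with \<open>w\<close> kills \<open>span U\<close>, so \<open>s\<close>
    is controlled by the bound \<open>B\<close> on \<open>X\<close>.\<close>
  have "s \<le> (norm w * B - w \<bullet> z) / (w \<bullet> v)" if sI: "s \<in> ?I" for s
  proof -
    obtain x where x: "x \<in> X" "z + s *\<^sub>R v - x \<in> span U" using sI by (auto simp: span_sat_def)
    have "w \<bullet> (z + s *\<^sub>R v - x) = 0" using yw(2)[OF x(2)] by (simp add: orthogonal_def)
    hence "w \<bullet> z + s * (w \<bullet> v) = w \<bullet> x" by (simp add: inner_simps)
    also have "\<dots> \<le> norm w * norm x" by (rule norm_cauchy_schwarz)
    also have "\<dots> \<le> norm w * B" by (intro mult_left_mono B x) simp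
    finally show ?thesis using wv by (simp add: field_simps)
  qed
  hence bdd: "bdd_above ?I" by (rule bdd_aboveI)
  show thesis
  proof (rule that)
    have "Sup ?I \<in> ?I" using ne by (intro closed_contains_Sup bdd cl) auto
    thus "z + Sup ?I *\<^sub>R v \<in> span_sat U X" by simp
    show "s \<le> Sup ?I" if "z + s *\<^sub>R v \<in> span_sat U X" for s
      using that bdd by (intro cSup_upper) auto
  qed
qed

text \<open>A lattice point of \<open>X + span (insert v U)\<close> can be moved along \<open>v\<close> by exactly one integer
  multiple into the half-open slab that \<open>X + [0,v] + span U\<close> adds to \<open>X + span U\<close>.\<close>

lemma card_lattice_classes_step:
  fixes X :: "(real^'n) set"
  assumes U: "finite U" "U \<subseteq> lattice_points" and v: "v \<in> lattice_points" "v \<notin> span U"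
    and X: "compact X" "convex X"
  shows "card (lattice_classes U (seg_sum X 1 v)) =
    card (lattice_classes U X) + card (lattice_classes (insert v U) X)"
proof -
  let ?S = "span_sat U X" and ?S' = "span_sat U (seg_sum X 1 v)"
  \<comment> \<open>\<open>D\<close> consists of the lattice points gained by adding the segment. It
    will turn out to contain exactly one class modulo \<open>U\<close> for each class of
    \<open>E\<close> modulo \<open>insert v U\<close>.\<close>
  define D where "D = lattice_points \<inter> (?S' - ?S)"
  define E where "E = lattice_points \<inter> span_sat (insert v U) X"
  have vU: "v \<notin> U" using v span_base by blast
  have mem': "z \<in> ?S' \<longleftrightarrow> (\<exists>t. 0 \<le> t \<and> t \<le> 1 \<and> z + (- t) *\<^sub>R v \<in> ?S)" for z
  proof
    assume "z \<in> ?S'"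
    then obtain x t where "x \<in> X" "0 \<le> t" "t \<le> 1" "z - (x + t *\<^sub>R v) \<in> span U"
      by (auto simp: span_sat_def seg_sum_def)
    moreover have "z + (- t) *\<^sub>R v - x = z - (x + t *\<^sub>R v)" by simp
    ultimately show "\<exists>t. 0 \<le> t \<and> t \<le> 1 \<and> z + (- t) *\<^sub>R v \<in> ?S"
      unfolding span_sat_def by (metis (mono_tags) mem_Collect_eq)
  next
    assume "\<exists>t. 0 \<le> t \<and> t \<le> 1 \<and> z + (- t) *\<^sub>R v \<in> ?S"
    then obtain x t where "x \<in> X" "0 \<le> t" "t \<le> 1" "z + (- t) *\<^sub>R v - x \<in> span U"
      by (auto simp: span_sat_def)
    moreover have "z + (- t) *\<^sub>R v - x = z - (x + t *\<^sub>R v)" by simp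
    moreover have "x + t *\<^sub>R v \<in> seg_sum X 1 v" using calculation by (auto simp: seg_sum_def)
    ultimately show "z \<in> ?S'"
      unfolding span_sat_def by (metis (mono_tags) mem_Collect_eq)
  qed
  have "x \<in> seg_sum X 1 v" if "x \<in> X" for x
    unfolding seg_sum_def by (rule CollectI, rule exI[of _ x], rule exI[of _ 0]) (use that in simp)
  hence SS: "?S \<subseteq> ?S'" by (auto simp: span_sat_def)
  have bd: "bounded (seg_sum X 1 v)"
    by (rule compact_imp_bounded[OF compact_seg_sum[OF X(1)]])
  have fin: "finite (lattice_classes U (seg_sum X 1 v))"
    by (rule finite_lattice_classes[OF U bd])
  have split: "lattice_classes U (seg_sum X 1 v) = lattice_classes U X \<union> int_coset U ` D"
    unfolding lattice_classes_def D_def using SS by auto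
  have disj: "lattice_classes U X \<inter> int_coset U ` D = {}"
  proof (rule ccontr)
    assume "\<not> ?thesis"
    then obtain x d where xd: "x \<in> ?S" "d \<notin> ?S" "int_coset U d = int_coset U x"
      unfolding lattice_classes_def D_def by auto
    hence "d - x \<in> span U" using int_span_subset_span by (auto simp: int_coset_eq_iff)
    thus False using span_sat_translate xd by blast
  qed
  \<comment> \<open>Modulo \<open>span U\<close>, the point \<open>d'\<close> is
    \<open>d + m v\<close>. If \<open>m \<ge> 1\<close>, then \<open>d - t v\<close> and
    \<open>d + (m - t') v\<close> both lie in \<open>?S\<close>, on either side of \<open>d\<close>;
    convexity would put \<open>d\<close> into \<open>?S\<close>, contrary to the choice of
    \<open>D\<close>.\<close>
  have key: "m \<le> 0" if d: "d \<in> D" "d' \<in> D" and g: "d' - d = g + of_int m *\<^sub>R v" "g \<in> int_span U"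
    for d d' g and m :: int
  proof (rule ccontr)
    assume "\<not> m \<le> 0"
    hence m: "m \<ge> 1" by simp
    obtain t where t: "0 \<le> t" "t \<le> 1" "d + (- t) *\<^sub>R v \<in> ?S"
      using d mem' unfolding D_def by auto
    obtain t' where t': "0 \<le> t'" "t' \<le> 1" "d' + (- t') *\<^sub>R v \<in> ?S"
      using d mem' unfolding D_def by auto
    have "(d + (of_int m - t') *\<^sub>R v) - (d' + (- t') *\<^sub>R v) = - g"
      using g by (simp add: algebra_simps)
    hence "d + (of_int m - t') *\<^sub>R v \<in> ?S"
      using span_sat_translate[OF t'(3)] g(2) int_span_subset_span[of U] int_span_uminus
      by (metis subsetD)
    hence "d + 0 *\<^sub>R v \<in> ?S"
      using convex_scalar_fibre[OF X(2) t(3)] t(1) t'(2) m by (smt (verit) of_int_1_le_iff)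
    thus False using d by (simp add: D_def)
  qed
  \<comment> \<open>Using \<open>key\<close> in both directions gives \<open>m = 0\<close>, so on
    \<open>D\<close> the two congruences agree.\<close>
  have fib: "int_coset U d = int_coset U d' \<longleftrightarrow> int_coset (insert v U) d = int_coset (insert v U) d'"
    if d: "d \<in> D" "d' \<in> D" for d d'
  proof
    assume "int_coset U d = int_coset U d'"
    hence "d - d' \<in> int_span U" by (simp add: int_coset_eq_iff)
    hence "\<exists>g\<in>int_span U. \<exists>m. d - d' = g + of_int m *\<^sub>R v"
      by (intro bexI[of _ "d - d'"] exI[of _ 0]) auto
    thus "int_coset (insert v U) d = int_coset (insert v U) d'"
      by (simp add: int_coset_eq_iff int_span_insert[OF U(1) vU])
  next
    assume "int_coset (insert v U) d = int_coset (insert v U) d'"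
    then obtain g m where g: "g \<in> int_span U" "d - d' = g + of_int m *\<^sub>R v"
      by (auto simp: int_coset_eq_iff int_span_insert[OF U(1) vU])
    have "m \<le> 0" using key[OF d(2) d(1) g(2) g(1)] .
    moreover have "d' - d = - g + of_int (- m) *\<^sub>R v"
    proof -
      have "d' - d = - (d - d')" by simp
      thus ?thesis unfolding g(2) by simp
    qed
    hence "- m \<le> 0" using key[OF d] int_span_uminus[OF g(1)] by blast
    ultimately show "int_coset U d = int_coset U d'" using g by (simp add: int_coset_eq_iff)
  qed
  have "int_coset (insert v U) ` D = int_coset (insert v U) ` E"
  proof
    have "d \<in> span_sat (insert v U) X" if d: "d \<in> ?S'" for d
    proof -
      obtain x t where "x \<in> X" "d - (x + t *\<^sub>R v) \<in> span U"
        using d by (auto simp: span_sat_def seg_sum_def)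
      moreover have "d - x = (d - (x + t *\<^sub>R v)) + t *\<^sub>R v" by simp
      moreover have "span U \<subseteq> span (insert v U)" by (rule span_mono) auto
      moreover have "t *\<^sub>R v \<in> span (insert v U)" by (simp add: span_base span_scale)
      ultimately have "d - x \<in> span (insert v U)" by (metis span_add subsetD)
      thus ?thesis using \<open>x \<in> X\<close> by (auto simp: span_sat_def)
    qed
    thus "int_coset (insert v U) ` D \<subseteq> int_coset (insert v U) ` E"
      by (auto simp: D_def E_def)
    show "int_coset (insert v U) ` E \<subseteq> int_coset (insert v U) ` D"
    proof (rule image_subsetI)
      fix e assume e: "e \<in> E"
      then obtain x where x: "x \<in> X" "e - x \<in> span (insert v U)" by (auto simp: E_def span_sat_def)
      then obtain k where "e - x - k *\<^sub>R v \<in> span U" by (auto simp: span_insert)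
      hence "e + (- k) *\<^sub>R v \<in> ?S" using x by (auto simp: span_sat_def algebra_simps)
      then obtain q where q: "e + q *\<^sub>R v \<in> ?S" "\<And>s. e + s *\<^sub>R v \<in> ?S \<Longrightarrow> s \<le> q"
        using last_scalar_in_fibre[OF X(1) v(2)] by metis
      \<comment> \<open>The first integer strictly beyond the last parameter \<open>q\<close>: the
        shifted point has left \<open>?S\<close> but is at most one step \<open>v\<close> away from
        it.\<close>
      define m where "m = \<lfloor>q\<rfloor> + 1"
      have m: "q < of_int m" "of_int m \<le> q + 1" unfolding m_def by linarith+
      let ?d = "e + of_int m *\<^sub>R v"
      have "?d \<notin> ?S" using q(2) m(1) by fastforce
      moreover have dq: "?d + (- (of_int m - q)) *\<^sub>R v = e + q *\<^sub>R v" by (simp add: algebra_simps)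
      have "?d \<in> ?S'" unfolding mem'
      proof (intro exI conjI)
        show "?d + (- (of_int m - q)) *\<^sub>R v \<in> ?S" unfolding dq by (rule q(1))
      qed (use m in auto)
      moreover have "?d \<in> lattice_points"
        using e v by (auto simp: E_def intro!: lattice_points_add lattice_points_scale)
      ultimately have "?d \<in> D" by (simp add: D_def)
      moreover have "e - ?d = 0 + of_int (- m) *\<^sub>R v" by simp
      hence "int_coset (insert v U) e = int_coset (insert v U) ?d"
        unfolding int_coset_eq_iff int_span_insert[OF U(1) vU] using int_span_zero by blast
      ultimately show "int_coset (insert v U) e \<in> int_coset (insert v U) ` D" by blast
    qed
  qed
  moreover have "card (int_coset U ` D) = card (int_coset (insert v U) ` D)"
    by (rule card_image_eq_if_same_fibres) (rule fib)
  ultimately have "card (int_coset U ` D) = card (lattice_classes (insert v U) X)"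
    unfolding lattice_classes_def E_def[symmetric] by simp
  moreover have "card (lattice_classes U (seg_sum X 1 v)) =
      card (lattice_classes U X) + card (int_coset U ` D)"
    unfolding split by (rule card_Un_disjoint) (use fin disj in \<open>auto simp: split\<close>)
  ultimately show ?thesis by simp
qed

section \<open>The Ehrhart polynomial of a zonotope\<close>

text \<open>The common coefficient range \<open>[a, b]\<close> covers the dilates \<open>k Z\<close>
  by \<open>[0, k]\<close>, the difference body by \<open>[-1, 1]\<close> and its dilates by
  \<open>[-l, l]\<close>.\<close>

fun zonotope :: "real \<Rightarrow> real \<Rightarrow> (real^'n) list \<Rightarrow> (real^'n) set" where
  "zonotope a b [] = {0}"
| "zonotope a b (v # vs) = {x + t *\<^sub>R v | x t. x \<in> zonotope a b vs \<and> a \<le> t \<and> t \<le> b}"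

text \<open>\<open>ehrhart_from vs U\<close> counts the lattice points of \<open>k * Z + span U\<close> modulo the lattice
  generated by \<open>U\<close>, where \<open>Z\<close> is the zonotope of \<open>vs\<close>.\<close>

fun ehrhart_from :: "(real^'n) list \<Rightarrow> (real^'n) set \<Rightarrow> real poly" where
  "ehrhart_from [] U = [:real (card (lattice_classes U {0})):]"
| "ehrhart_from (v # vs) U = ehrhart_from vs U +
     (if v \<in> span U then 0 else pCons 0 (ehrhart_from vs (insert v U)))"

text \<open>Runs over the ordered ways to extend \<open>U\<close> by \<open>i\<close> generators,
  each outside the span of \<open>U\<close> and the ones before it, and adds up the indices reached.
  Repeated entries of \<open>vs\<close> count separately.\<close>

fun extension_sum :: "(real^'n) list \<Rightarrow> nat \<Rightarrow> (real^'n) set \<Rightarrow> real" where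
  "extension_sum vs 0 U = real (card (lattice_classes U {0}))"
| "extension_sum vs (Suc i) U =
     (\<Sum>v\<leftarrow>vs. if v \<in> span U then 0 else extension_sum vs i (insert v U))"

lemma zonotope_Cons_seg_sum: "zonotope 0 k (v # vs) = seg_sum (zonotope 0 k vs) k v"
  by (simp add: seg_sum_def)

lemma compact_zonotope: "compact (zonotope a b vs)"
  by (induction vs) (simp_all add: compact_sum_segment)

lemma convex_zonotope: "convex (zonotope a b vs)"
  by (induction vs) (simp_all add: convex_sum_segment)

lemma seg_sum_Suc: "seg_sum X (1 + real k) v = seg_sum (seg_sum X (real k) v) 1 v"
proof (intro equalityI subsetI)
  fix z assume "z \<in> seg_sum X (1 + real k) v"
  then obtain x t where z: "z = x + t *\<^sub>R v" "x \<in> X" "0 \<le> t" "t \<le> 1 + real k"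
    by (auto simp: seg_sum_def)
  have "z = (x + min t (real k) *\<^sub>R v) + (t - min t (real k)) *\<^sub>R v"
    by (simp add: z(1) scaleR_left_diff_distrib)
  moreover have "x + min t (real k) *\<^sub>R v \<in> seg_sum X (real k) v"
    unfolding seg_sum_def
    by (rule CollectI, rule exI[of _ x], rule exI[of _ "min t (real k)"]) (use z in simp)
  moreover have "0 \<le> t - min t (real k)" "t - min t (real k) \<le> 1" using z by auto
  ultimately show "z \<in> seg_sum (seg_sum X (real k) v) 1 v" unfolding seg_sum_def by blast
next
  fix z assume "z \<in> seg_sum (seg_sum X (real k) v) 1 v"
  then obtain x s t where z: "z = x + s *\<^sub>R v + t *\<^sub>R v" "x \<in> X" "0 \<le> s" "s \<le> real k" "0 \<le> t" "t \<le> 1"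
    by (auto simp: seg_sum_def)
  have z': "z = x + (s + t) *\<^sub>R v" using z by (simp add: algebra_simps)
  show "z \<in> seg_sum X (1 + real k) v"
    unfolding seg_sum_def
    by (rule CollectI, rule exI[of _ x], rule exI[of _ "s + t"]) (use z z' in simp)
qed

lemma span_sat_seg_sum:
  assumes "v \<in> span U" "k \<ge> 0"
  shows "span_sat U (seg_sum X k v) = span_sat U X"
proof (intro equalityI subsetI)
  fix z assume "z \<in> span_sat U (seg_sum X k v)"
  then obtain x t where "x \<in> X" "z - (x + t *\<^sub>R v) \<in> span U"
    by (auto simp: span_sat_def seg_sum_def)
  moreover have "z - x = (z - (x + t *\<^sub>R v)) + t *\<^sub>R v" by simp
  ultimately have "z - x \<in> span U" using assms span_add span_scale by metis
  thus "z \<in> span_sat U X" using \<open>x \<in> X\<close> by (auto simp: span_sat_def)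
next
  fix z assume "z \<in> span_sat U X"
  moreover have "x \<in> seg_sum X k v" if "x \<in> X" for x
    unfolding seg_sum_def by (rule CollectI, rule exI[of _ x], rule exI[of _ 0]) (use that assms in simp)
  ultimately show "z \<in> span_sat U (seg_sum X k v)" by (auto simp: span_sat_def)
qed

text \<open>Attach \<open>k\<close> unit segments one after another. Each adds the same amount,
  since multiples of \<open>v\<close> attached earlier vanish modulo
  \<open>span (insert v U)\<close>.\<close>

lemma card_lattice_classes_seg_sum:
  fixes X :: "(real^'n) set"
  assumes U: "finite U" "U \<subseteq> lattice_points" and v: "v \<in> lattice_points" "v \<notin> span U"
    and X: "compact X" "convex X"
  shows "card (lattice_classes U (seg_sum X (real k) v)) =
    card (lattice_classes U X) + k * card (lattice_classes (insert v U) X)"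
proof (induction k)
  case 0
  have "z \<in> seg_sum X (real 0) v \<longleftrightarrow> z \<in> X" for z
    unfolding seg_sum_def by (auto dest: order_antisym intro!: exI[of _ z] exI[of _ "0::real"])
  hence "seg_sum X (real 0) v = X" by blast
  thus ?case by simp
next
  case (Suc k)
  have "v \<in> span (insert v U)" by (simp add: span_base)
  hence eq: "lattice_classes (insert v U) (seg_sum X (real k) v) = lattice_classes (insert v U) X"
    by (simp add: lattice_classes_def span_sat_seg_sum)
  have "card (lattice_classes U (seg_sum X (real (Suc k)) v)) =
      card (lattice_classes U (seg_sum (seg_sum X (real k) v) 1 v))"
    by (simp add: seg_sum_Suc)
  also have "\<dots> = card (lattice_classes U (seg_sum X (real k) v)) + card (lattice_classes (insert v U) X)"
    using card_lattice_classes_step[OF U v compact_seg_sum[OF X(1)] convex_seg_sum[OF X(2)]]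
    by (simp add: eq)
  finally show ?case using Suc by simp
qed

text \<open>Induction on the generators, where \<open>pCons 0\<close> supplies the factor
  \<open>k\<close> of the previous count. The set \<open>U\<close> has to vary because this step
  enlarges it.\<close>

lemma poly_ehrhart_from:
  fixes vs :: "(real^'n) list"
  assumes "finite U" "U \<subseteq> lattice_points" "set vs \<subseteq> lattice_points"
  shows "poly (ehrhart_from vs U) (real k) = real (card (lattice_classes U (zonotope 0 (real k) vs)))"
  using assms
proof (induction vs arbitrary: U)
  case (Cons v vs)
  show ?case
  proof (cases "v \<in> span U")
    case True
    hence "lattice_classes U (zonotope 0 (real k) (v # vs)) = lattice_classes U (zonotope 0 (real k) vs)"
      unfolding zonotope_Cons_seg_sum by (simp add: lattice_classes_def span_sat_seg_sum)
    thus ?thesis using Cons True by simp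
  next
    case False
    have "real (card (lattice_classes U (zonotope 0 (real k) (v # vs)))) =
        real (card (lattice_classes U (zonotope 0 (real k) vs))) +
        real k * real (card (lattice_classes (insert v U) (zonotope 0 (real k) vs)))"
      unfolding zonotope_Cons_seg_sum
      using card_lattice_classes_seg_sum[OF Cons.prems(1,2) _ False compact_zonotope convex_zonotope]
        Cons.prems(3) by simp
    thus ?thesis using Cons False by simp
  qed
qed simp

text \<open>Every factor of the variable is paid for by one further independent vector in
  \<open>U\<close>.\<close>

lemma degree_ehrhart_from:
  fixes U :: "(real^'n) set"
  assumes "independent U"
  shows "degree (ehrhart_from vs U) + card U \<le> CARD('n)"
  using assms
proof (induction vs arbitrary: U)
  case Nil
  thus ?case using independent_bound[of U] by simp
next
  case (Cons v vs)
  show ?case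
  proof (cases "v \<in> span U")
    case False
    have i: "independent (insert v U)" using Cons.prems False independent_insertI by blast
    have "v \<notin> U" using False span_base by blast
    hence c: "card (insert v U) = Suc (card U)" using independent_bound[OF Cons.prems] by simp
    have "degree (ehrhart_from (v # vs) U) \<le>
        max (degree (ehrhart_from vs U)) (Suc (degree (ehrhart_from vs (insert v U))))"
      using False by (auto intro!: degree_add_le order_trans[OF degree_pCons_le])
    thus ?thesis using Cons.IH[OF Cons.prems] Cons.IH[OF i] c by simp
  qed (use Cons in simp)
qed

section \<open>Derivative and coefficients of the counting polynomial\<close>

lemma span_insert_exchange:
  assumes "v \<notin> span U" "w \<notin> span U"
  shows "w \<in> span (insert v U) \<longleftrightarrow> v \<in> span (insert w U)"
  using assms in_span_insert by blast

lemma sum_list_pCons_0: "(\<Sum>x\<leftarrow>xs. pCons 0 (f x)) = pCons 0 (\<Sum>x\<leftarrow>xs. f x)"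
  by (induction xs) simp_all

text \<open>Applied to the summand with \<open>pCons 0\<close>, the product rule yields the term of
  the head \<open>v\<close> and the variable times another derivative. The latter belongs to the
  remaining generators \<open>w\<close>, because adding \<open>v\<close> and \<open>w\<close> to
  \<open>U\<close> in either order gives the same set.\<close>

lemma pderiv_ehrhart_from:
  "pderiv (ehrhart_from vs U) =
    (\<Sum>v\<leftarrow>vs. if v \<in> span U then 0 else ehrhart_from vs (insert v U))"
proof (induction vs arbitrary: U)
  case Nil
  show ?case by (simp add: pderiv_pCons)
next
  case (Cons v vs)
  let ?d = "\<lambda>U w. if w \<in> span U then 0 else ehrhart_from vs (insert w U)"
  show ?case
  proof (cases "v \<in> span U")
    case True
    have "v \<in> span (insert w U)" for w using True span_mono[of U "insert w U"] by auto
    hence "(if w \<in> span U then 0 else ehrhart_from (v # vs) (insert w U)) = ?d U w" for w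
      by simp
    thus ?thesis using Cons True by simp
  next
    case False
    have vv: "v \<in> span (insert v U)" by (simp add: span_base)
    \<comment> \<open>For \<open>v\<close> and \<open>w\<close> outside \<open>span U\<close>, the
      exchange property says that \<open>w\<close> depends on \<open>insert v U\<close> exactly when
      \<open>v\<close> depends on \<open>insert w U\<close>, so the extra terms on both sides vanish
      together.\<close>
    have *: "(if w \<in> span U then 0 else ehrhart_from (v # vs) (insert w U)) =
        ?d U w + pCons 0 (?d (insert v U) w)" for w
    proof (cases "w \<in> span U")
      case True
      hence "w \<in> span (insert v U)" using span_mono[of U "insert v U"] by auto
      thus ?thesis using True by simp
    next
      case w: False
      show ?thesis using w span_insert_exchange[OF False w] by (simp add: insert_commute)
    qed
    have "(\<Sum>w\<leftarrow>vs. if w \<in> span U then 0 else ehrhart_from (v # vs) (insert w U)) =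
        pderiv (ehrhart_from vs U) + pCons 0 (pderiv (ehrhart_from vs (insert v U)))"
      unfolding * by (simp only: sum_list_addf Cons sum_list_pCons_0)
    thus ?thesis using False vv by (simp add: pderiv_add pderiv_pCons)
  qed
qed

lemma coeff_sum_list: "coeff (\<Sum>x\<leftarrow>xs. f x) i = (\<Sum>x\<leftarrow>xs. coeff (f x) i)"
  by (induction xs) simp_all

lemma poly_0_ehrhart_from: "coeff (ehrhart_from vs U) 0 = real (card (lattice_classes U {0}))"
  by (induction vs arbitrary: U) simp_all

text \<open>Each differentiation extends \<open>U\<close> by one generator; after \<open>i\<close>
  of them the constant term is the index of the lattice generated by the extended set.\<close>

lemma coeff_ehrhart_from: "fact i * coeff (ehrhart_from vs U) i = extension_sum vs i U"
proof (induction i arbitrary: U)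
  case 0
  show ?case by (simp add: poly_0_ehrhart_from)
next
  case (Suc i)
  have "fact (Suc i) * coeff (ehrhart_from vs U) (Suc i) = fact i * coeff (pderiv (ehrhart_from vs U)) i"
    by (simp add: coeff_pderiv)
  also have "\<dots> = (\<Sum>v\<leftarrow>vs. fact i * coeff (if v \<in> span U then 0 else ehrhart_from vs (insert v U)) i)"
    by (simp add: pderiv_ehrhart_from coeff_sum_list sum_list_const_mult)
  also have "\<dots> = (\<Sum>v\<leftarrow>vs. if v \<in> span U then 0 else extension_sum vs i (insert v U))"
    by (intro arg_cong[of _ _ sum_list] map_cong) (auto simp: Suc)
  finally show ?case by simp
qed

section \<open>Determinants and indices\<close>

text \<open>An arbitrary numbering of the coordinates from \<open>0\<close>, linking lists of
  vectors to matrices. Changing it could alter \<open>list_det\<close> only by a sign.\<close>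

definition index_of :: "'n::finite \<Rightarrow> nat" where
  "index_of = (SOME f. bij_betw f UNIV {..<CARD('n)})"

definition list_det :: "(real^'n) list \<Rightarrow> real" where
  "list_det xs = det (\<chi> i. xs ! index_of i)"

definition list_comb :: "(real^'n) list \<Rightarrow> real^'n \<Rightarrow> real^'n" where
  "list_comb xs x = (\<Sum>i\<in>UNIV. x $ i *\<^sub>R xs ! index_of i)"

lemma bij_index_of: "bij_betw (index_of :: 'n::finite \<Rightarrow> nat) UNIV {..<CARD('n)}"
proof -
  have "\<exists>f. bij_betw f (UNIV :: 'n set) {..<CARD('n)}"
    by (intro finite_same_card_bij) auto
  thus ?thesis unfolding index_of_def by (rule someI_ex)
qed

lemma linear_list_comb: "linear (list_comb xs)"
  by (rule linearI) (auto simp: list_comb_def algebra_simps sum.distrib scaleR_sum_right)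

lemma list_comb_axis: "list_comb xs (axis j 1) = xs ! index_of j"
  by (simp add: list_comb_def axis_def if_distrib[of "\<lambda>c. c *\<^sub>R _"] cong: if_cong)

lemma det_matrix_list_comb: "det (matrix (list_comb xs)) = list_det xs"
proof -
  have "matrix (list_comb xs) = transpose (\<chi> i. xs ! index_of i)"
    by (simp add: matrix_def transpose_def list_comb_axis)
  thus ?thesis by (simp add: det_transpose list_det_def)
qed

lemma bij_nth_index_of:
  fixes xs :: "(real^'n) list"
  assumes "distinct xs" "length xs = CARD('n)"
  shows "bij_betw (\<lambda>i::'n. xs ! index_of i) UNIV (set xs)"
  using bij_betw_trans[OF bij_index_of bij_betw_nth[OF assms(1), of "{..<CARD('n)}" "set xs"]] assms(2)
  by (simp add: comp_def)

lemma list_comb_eq_sum: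
  fixes xs :: "(real^'n) list"
  assumes "distinct xs" "length xs = CARD('n)"
  obtains p where "bij_betw p (set xs) (UNIV :: 'n set)"
    "\<And>x. list_comb xs x = (\<Sum>u\<in>set xs. x $ p u *\<^sub>R u)"
proof
  let ?f = "\<lambda>i::'n. xs ! index_of i"
  note b = bij_nth_index_of[OF assms]
  show "bij_betw (the_inv_into UNIV ?f) (set xs) UNIV" by (rule bij_betw_the_inv_into[OF b])
  fix x :: "real^'n"
  have inj: "inj ?f" using b by (simp add: bij_betw_def)
  show "list_comb xs x = (\<Sum>u\<in>set xs. x $ the_inv_into UNIV ?f u *\<^sub>R u)"
    unfolding list_comb_def sum.reindex_bij_betw[OF b, symmetric]
    by (simp add: the_inv_into_f_f[OF inj])
qed

lemma inj_list_comb: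
  fixes xs :: "(real^'n) list"
  assumes xs: "distinct xs" "length xs = CARD('n)" and ind: "independent (set xs)"
  shows "inj (list_comb xs)"
proof (subst linear_injective_0[OF linear_list_comb], intro allI impI)
  fix x assume x: "list_comb xs x = 0"
  obtain p where p: "bij_betw p (set xs) (UNIV :: 'n set)"
    "\<And>x. list_comb xs x = (\<Sum>u\<in>set xs. x $ p u *\<^sub>R u)" using list_comb_eq_sum[OF xs] by blast
  have "x $ p u = 0" if "u \<in> set xs" for u
    using independentD[OF ind, of "set xs" "\<lambda>u. x $ p u" u] x p(2) that by simp
  thus "x = 0" using p(1) unfolding bij_betw_def by (metis UNIV_I imageE vec_eq_iff zero_index)
qed

text \<open>A nonzero determinant would let the entries other than \<open>v\<close> span the whole
  space, but there are only \<open>n - 1\<close> of them.\<close>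

lemma list_det_eq_0:
  fixes us ws :: "(real^'n) list"
  assumes len: "length us + length ws + 1 = CARD('n)" and v: "v \<in> span (set us)"
  shows "list_det (us @ v # ws) = 0"
proof (rule ccontr)
  assume "list_det (us @ v # ws) \<noteq> 0"
  hence "inj (list_comb (us @ v # ws))"
    using det_nz_iff_inj[OF linear_list_comb[of "us @ v # ws"]] by (simp add: det_matrix_list_comb)
  hence s: "surj (list_comb (us @ v # ws))"
    by (rule linear_injective_imp_surjective[OF linear_list_comb _ refl])
  have "index_of (i::'n) < length (us @ v # ws)" for i
    using bij_index_of len by (auto simp: bij_betw_def)
  hence "(us @ v # ws) ! index_of (i::'n) \<in> set (us @ v # ws)" for i
    by (rule nth_mem)
  hence "list_comb (us @ v # ws) x \<in> span (set (us @ v # ws))" for x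
    unfolding list_comb_def by (intro span_sum span_scale span_base)
  moreover have "span (set (us @ v # ws)) = span (set (us @ ws))"
  proof -
    have "v \<in> span (set (us @ ws))" using v span_mono[of "set us" "set (us @ ws)"] by auto
    moreover have "set (us @ v # ws) = insert v (set (us @ ws))" by auto
    ultimately show ?thesis using span_redundant by metis
  qed
  ultimately have "span (set (us @ ws)) = UNIV" using s by (metis UNIV_eq_I surjD)
  hence "CARD('n) = dim (set (us @ ws))" using dim_eq_full[of "set (us @ ws)"] by simp
  also have "\<dots> \<le> card (set (us @ ws))" by (rule dim_le_card') simp
  also have "\<dots> \<le> length (us @ ws)" by (rule card_length)
  finally show False using len by simp
qed

lemma linear_list_det:
  fixes us ws :: "(real^'n) list"
  assumes len: "length us + length ws + 1 = CARD('n)"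
  shows "linear (\<lambda>x. list_det (us @ x # ws))"
proof -
  obtain k :: 'n where k: "index_of k = length us"
    using bij_index_of[where 'n='n] len unfolding bij_betw_def
    by (metis UNIV_I add.assoc image_iff less_add_Suc1 lessThan_iff add_Suc_right Suc_eq_plus1)
  have kk: "index_of i = length us \<longleftrightarrow> i = k" for i
    using bij_index_of[where 'n='n] unfolding k[symmetric] bij_betw_def by (simp add: inj_eq)
  \<comment> \<open>The \<open>0\<close> is a placeholder at the position of the variable row;
    \<open>k\<close> is the coordinate numbered by that position.\<close>
  let ?c = "\<lambda>i::'n. (us @ 0 # ws) ! index_of i"
  have eq: "list_det (us @ x # ws) = det (\<chi> i. if i = k then x else ?c i)" for x
  proof -
    have "(us @ x # ws) ! index_of i = (if i = k then x else ?c i)" for i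
      using kk[of i] by (auto simp: nth_append nth_Cons')
    thus ?thesis by (simp add: list_det_def)
  qed
  show ?thesis
  proof (rule linearI)
    show "list_det (us @ (x + y) # ws) = list_det (us @ x # ws) + list_det (us @ y # ws)" for x y
      unfolding eq by (rule det_row_add)
    show "list_det (us @ (c *\<^sub>R x) # ws) = c *\<^sub>R list_det (us @ x # ws)" for c x
      unfolding eq scalar_mult_eq_scaleR[symmetric] by (simp add: det_row_mul)
  qed
qed

text \<open>The triangle inequality, with coefficients of absolute value at most \<open>l\<close>.
  It will be applied to the determinant as a function of one row.\<close>

lemma abs_linear_zonotope_le:
  fixes f :: "real^'n \<Rightarrow> real"
  assumes f: "linear f" and b: "b \<in> zonotope (- l) l vs"
  shows "\<bar>f b\<bar> \<le> l * (\<Sum>v\<leftarrow>vs. \<bar>f v\<bar>)"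
  using b
proof (induction vs arbitrary: b)
  case Nil
  thus ?case using linear_0[OF f] by simp
next
  case (Cons v vs)
  then obtain x t where b: "b = x + t *\<^sub>R v" "x \<in> zonotope (- l) l vs" "\<bar>t\<bar> \<le> l"
    by (auto simp: abs_le_iff)
  have "\<bar>f b\<bar> \<le> \<bar>f x\<bar> + \<bar>t\<bar> * \<bar>f v\<bar>"
    unfolding b(1) linear_add[OF f] linear_scale[OF f] using abs_triangle_ineq[of "f x" "t * f v"]
    by (simp add: abs_mult)
  also have "\<dots> \<le> l * (\<Sum>v\<leftarrow>vs. \<bar>f v\<bar>) + l * \<bar>f v\<bar>"
    by (intro add_mono Cons.IH b mult_right_mono) simp
  finally show ?case by (simp add: algebra_simps)
qed

section \<open>Comparing indices with determinants through volumes\<close>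

lemma span_sat_zero [simp]: "span_sat U {0} = span U"
  by (auto simp: span_sat_def)

lemma
  fixes R :: "(real^'n) set"
  assumes fin: "finite R" and R: "R \<subseteq> lattice_points"
  shows lmeasurable_lattice_cells: "(\<Union>r\<in>R. (+) r ` unit_cube) \<in> lmeasurable"
    and measure_lattice_cells: "measure lebesgue (\<Union>r\<in>R. (+) r ` unit_cube) = real (card R)"
proof -
  have m: "(+) r ` unit_cube \<in> lmeasurable" for r :: "real^'n"
    by (rule measurable_translation[OF unit_cube_lmeasurable])
  show "(\<Union>r\<in>R. (+) r ` unit_cube) \<in> lmeasurable"
    using m fin by (simp add: fmeasurable.finite_UN)
  have "measure lebesgue (\<Union>r\<in>R. (+) r ` unit_cube) = (\<Sum>r\<in>R. measure lebesgue ((+) r ` unit_cube))"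
  proof (rule measure_finite_Union[OF fin])
    show "(\<lambda>r. (+) r ` unit_cube) ` R \<subseteq> sets lebesgue" using m by (auto dest: fmeasurableD)
    show "disjoint_family_on (\<lambda>r. (+) r ` unit_cube) R"
    proof (unfold disjoint_family_on_def, intro ballI impI)
      fix r s assume rs: "r \<in> R" "s \<in> R" "r \<noteq> s"
      show "(+) r ` unit_cube \<inter> (+) s ` unit_cube = {}"
      proof (rule ccontr)
        assume "\<not> ?thesis"
        then obtain f g where fg: "f \<in> unit_cube" "g \<in> unit_cube" "r + f = s + g" by auto
        hence "f - g = s - r" by (simp add: algebra_simps)
        hence "f - g \<in> lattice_points" using rs R lattice_points_diff by auto
        hence "f = g" using unit_cube_inj fg by blast
        thus False using fg rs by simp
      qed
    qed
    show "emeasure lebesgue ((+) r ` unit_cube) \<noteq> \<infinity>" for r :: "real^'n"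
      using fmeasurableD2[OF m[of r]] by simp
  qed
  thus "measure lebesgue (\<Union>r\<in>R. (+) r ` unit_cube) = real (card R)"
    by (simp add: measure_translation measure_unit_cube)
qed

text \<open>Attaching a unit cube to one representative of each class turns the index into a volume,
  which can then be compared with the volume of a parallelepiped.\<close>

lemma obtain_class_cells:
  fixes U :: "(real^'n) set"
  assumes U: "finite U" "U \<subseteq> lattice_points"
  obtains R where "R \<subseteq> lattice_points \<inter> span U" "inj_on (int_coset U) R"
    "lattice_classes U {0} = int_coset U ` R"
    "(\<Union>r\<in>R. (+) r ` unit_cube) \<in> lmeasurable"
    "measure lebesgue (\<Union>r\<in>R. (+) r ` unit_cube) = real (card (lattice_classes U {0}))"
proof -
  obtain R where R: "R \<subseteq> lattice_points \<inter> span U" "inj_on (int_coset U) R"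
    "lattice_classes U {0} = int_coset U ` R"
    using subset_image_inj[of "lattice_classes U {0}" "int_coset U" "lattice_points \<inter> span U"]
    by (auto simp: lattice_classes_def)
  have "finite R" using finite_lattice_classes[OF U, of "{0}"] R finite_imageD by fastforce
  moreover have "R \<subseteq> lattice_points" using R(1) by blast
  moreover have "card R = card (lattice_classes U {0})" using R by (simp add: card_image)
  ultimately show thesis
    using that[OF R] lmeasurable_lattice_cells measure_lattice_cells by metis
qed

text \<open>The half-open parallelepiped \<open>?M\<close>
  unit_cube\<open>covers space modulo the lattice\<close>?M \<open>lattice_points\<close>. The cubes
  at the representatives form a packing modulo the same lattice, since its elements inside the span
  of \<open>us\<close> are already integer combinations of \<open>us\<close>.\<close>

lemma card_lattice_classes_le_det:
  fixes us ws :: "(real^'n) list"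
  assumes d: "distinct (us @ ws)" and len: "length (us @ ws) = CARD('n)"
    and ind: "independent (set (us @ ws))" and lat: "set (us @ ws) \<subseteq> lattice_points"
  shows "real (card (lattice_classes (set us) {0})) \<le> \<bar>list_det (us @ ws)\<bar>"
proof -
  let ?U = "set us" and ?M = "list_comb (us @ ws)"
  obtain p where p: "bij_betw p (set (us @ ws)) (UNIV :: 'n set)"
    "\<And>x. ?M x = (\<Sum>u\<in>set (us @ ws). x $ p u *\<^sub>R u)" using list_comb_eq_sum[OF d len] by blast
  have "finite ?U" "?U \<subseteq> lattice_points" using lat by auto
  note cells = obtain_class_cells[OF this]
  obtain R where R: "R \<subseteq> lattice_points \<inter> span ?U" "inj_on (int_coset ?U) R"
    "lattice_classes ?U {0} = int_coset ?U ` R"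
    "(\<Union>r\<in>R. (+) r ` unit_cube) \<in> lmeasurable"
    "measure lebesgue (\<Union>r\<in>R. (+) r ` unit_cube) = real (card (lattice_classes ?U {0}))"
    by (rule cells)
  have lin: "linear ?M" by (rule linear_list_comb)
  have Mlat: "?M z \<in> lattice_points" if "z \<in> lattice_points" for z
    unfolding p(2) using that lat by (intro lattice_points_sum lattice_points_scale) (auto simp: lattice_points_def)
  \<comment> \<open>By independence the coordinates of \<open>?M z\<close> are unique: those along
    \<open>us\<close> are the integers in \<open>z\<close>, and those along \<open>ws\<close>
    vanish.\<close>
  have restrict: "?M z \<in> int_span ?U" if z: "z \<in> lattice_points" "?M z \<in> span ?U" for z
  proof -
    obtain c where c: "?M z = (\<Sum>u\<in>?U. c u *\<^sub>R u)" using z(2) span_finite[of ?U] by auto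
    have UW: "set (us @ ws) = ?U \<union> set ws" "?U \<inter> set ws = {}" using d by auto
    have "(\<Sum>u\<in>?U. c u *\<^sub>R u) = (\<Sum>u\<in>set (us @ ws). (if u \<in> ?U then c u else 0) *\<^sub>R u)"
      by (rule sum.mono_neutral_cong_left) auto
    hence "(\<Sum>u\<in>set (us @ ws). (z $ p u - (if u \<in> ?U then c u else 0)) *\<^sub>R u) = 0"
      using c p(2)[of z] by (simp add: scaleR_left_diff_distrib sum_subtractf)
    hence 0: "z $ p u - (if u \<in> ?U then c u else 0) = 0" if "u \<in> set (us @ ws)" for u
      using independentD[OF ind, of "set (us @ ws)" "\<lambda>u. z $ p u - (if u \<in> ?U then c u else 0)" u] that
      by simp
    have "c u = of_int \<lfloor>z $ p u\<rfloor>" if "u \<in> ?U" for u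
    proof -
      have "c u = z $ p u" using 0[of u] that by simp
      moreover have "z $ p u \<in> \<int>" using z(1) by (simp add: lattice_points_def)
      ultimately show ?thesis by (auto elim: Ints_cases)
    qed
    hence "?M z = (\<Sum>u\<in>?U. of_int \<lfloor>z $ p u\<rfloor> *\<^sub>R u)" unfolding c by (intro sum.cong) auto
    thus ?thesis using int_spanI[of "\<lambda>u. \<lfloor>z $ p u\<rfloor>" ?U] by simp
  qed
  have sur: "surj ?M"
    by (rule linear_injective_imp_surjective[OF lin inj_list_comb[OF d len ind] refl])
  have "measure lebesgue (\<Union>r\<in>R. (+) r ` unit_cube) \<le> measure lebesgue (?M ` unit_cube)"
  proof (rule transversal_measure_le)
    show "countable (?M ` lattice_points)" by (intro countable_image countable_lattice_points)
    show "(\<Union>r\<in>R. (+) r ` unit_cube) \<in> lmeasurable" by (rule R(4))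
    show "?M ` unit_cube \<in> lmeasurable"
      by (rule lmeasurable_linear_image[OF lin unit_cube_lmeasurable])
    fix x y assume x: "x \<in> (\<Union>r\<in>R. (+) r ` unit_cube)" and y: "y \<in> (\<Union>r\<in>R. (+) r ` unit_cube)"
      and xy: "x - y \<in> ?M ` lattice_points"
    obtain r f s g where rs: "r \<in> R" "s \<in> R" "f \<in> unit_cube" "g \<in> unit_cube" "x = r + f" "y = s + g"
      using x y by auto
    obtain z where z: "z \<in> lattice_points" "x - y = ?M z" using xy by auto
    have "f - g = ?M z - (r - s)" using z rs by (simp add: algebra_simps)
    moreover have "r - s \<in> lattice_points" using rs R(1) lattice_points_diff by auto
    ultimately have "f - g \<in> lattice_points" using Mlat[OF z(1)] lattice_points_diff by metis
    hence fg: "f = g" using unit_cube_inj rs by blast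
    hence "?M z = r - s" using z rs by simp
    moreover have "r - s \<in> span ?U" using rs R(1) by (intro span_diff) auto
    ultimately have "r - s \<in> int_span ?U" using restrict[OF z(1)] by simp
    hence "r = s" using R(2) rs by (auto simp: int_coset_eq_iff inj_on_def)
    thus "x = y" using rs fg by simp
  next
    fix g h assume "g \<in> ?M ` lattice_points" "h \<in> ?M ` lattice_points"
    thus "g - h \<in> ?M ` lattice_points"
      by (auto simp: linear_diff[OF lin, symmetric] intro: lattice_points_diff)
  next
    fix x :: "real^'n"
    obtain y where y: "x = ?M y" using sur by (metis surjD)
    obtain g where g: "g \<in> lattice_points" "y - g \<in> unit_cube" using unit_cube_cover by blast
    have "x - ?M g = ?M (y - g)" by (simp add: y linear_diff[OF lin])
    thus "\<exists>g\<in>?M ` lattice_points. x - g \<in> ?M ` unit_cube" using g by blast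
  qed
  thus ?thesis
    by (simp add: R(5) measure_lebesgue_linear_image[OF lin unit_cube_lmeasurable] measure_unit_cube
        det_matrix_list_comb)
qed

text \<open>Here the parallelepiped is the packing and the cubes are the covering. The cubes cover
  because the vectors span the whole space, so that every lattice point is congruent to a
  representative.\<close>

lemma det_le_card_lattice_classes:
  fixes us :: "(real^'n) list"
  assumes d: "distinct us" and len: "length us = CARD('n)"
    and ind: "independent (set us)" and lat: "set us \<subseteq> lattice_points"
  shows "\<bar>list_det us\<bar> \<le> real (card (lattice_classes (set us) {0}))"
proof -
  let ?U = "set us" and ?M = "list_comb us"
  obtain p where p: "bij_betw p (set us) (UNIV :: 'n set)"
    "\<And>x. ?M x = (\<Sum>u\<in>set us. x $ p u *\<^sub>R u)" using list_comb_eq_sum[OF d len] by blast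
  have "finite ?U" "?U \<subseteq> lattice_points" using lat by auto
  note cells = obtain_class_cells[OF this]
  obtain R where R: "R \<subseteq> lattice_points \<inter> span ?U" "inj_on (int_coset ?U) R"
    "lattice_classes ?U {0} = int_coset ?U ` R"
    "(\<Union>r\<in>R. (+) r ` unit_cube) \<in> lmeasurable"
    "measure lebesgue (\<Union>r\<in>R. (+) r ` unit_cube) = real (card (lattice_classes ?U {0}))"
    by (rule cells)
  have lin: "linear ?M" by (rule linear_list_comb)
  have inj: "inj ?M" by (rule inj_list_comb[OF d len ind])
  have pre: "\<exists>z\<in>lattice_points. x = ?M z" if x: "x \<in> int_span ?U" for x
  proof -
    obtain c where c: "x = (\<Sum>u\<in>?U. of_int (c u) *\<^sub>R u)" using x by (auto simp: int_span_def)
    let ?z = "(\<chi> i. of_int (c (the_inv_into (set us) p i))) :: real^'n"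
    have "?M ?z = x" unfolding c p(2)
      using p(1) by (intro sum.cong) (auto simp: bij_betw_def the_inv_into_f_f)
    moreover have "?z \<in> lattice_points" by (simp add: lattice_points_def)
    ultimately show ?thesis by metis
  qed
  have "card (set us) = DIM(real^'n)" using distinct_card[OF d] len by simp
  hence full: "span ?U = UNIV"
    using dim_eq_card_independent[OF ind] dim_eq_full[of ?U] by simp
  have "measure lebesgue (?M ` unit_cube) \<le> measure lebesgue (\<Union>r\<in>R. (+) r ` unit_cube)"
  proof (rule transversal_measure_le)
    show "countable (int_span ?U)"
      by (rule countable_subset[OF int_span_subset_lattice[OF lat] countable_lattice_points])
    show "(\<Union>r\<in>R. (+) r ` unit_cube) \<in> lmeasurable" by (rule R(4))
    show "?M ` unit_cube \<in> lmeasurable"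
      by (rule lmeasurable_linear_image[OF lin unit_cube_lmeasurable])
    show "g - h \<in> int_span ?U" if "g \<in> int_span ?U" "h \<in> int_span ?U" for g h
      using that by (rule int_span_diff)
    fix x y assume x: "x \<in> ?M ` unit_cube" and y: "y \<in> ?M ` unit_cube" and xy: "x - y \<in> int_span ?U"
    obtain f g where fg: "f \<in> unit_cube" "g \<in> unit_cube" "x = ?M f" "y = ?M g" using x y by auto
    obtain z where z: "z \<in> lattice_points" "x - y = ?M z" using pre[OF xy] by auto
    hence "?M (f - g) = ?M z" using fg by (simp add: linear_diff[OF lin])
    hence "f - g = z" using inj by (simp add: inj_eq)
    thus "x = y" using unit_cube_inj fg z by blast
  next
    fix x :: "real^'n"
    obtain g where g: "g \<in> lattice_points" "x - g \<in> unit_cube" using unit_cube_cover by blast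
    have "int_coset ?U g \<in> int_coset ?U ` R"
      using g full unfolding R(3)[symmetric] lattice_classes_def by simp
    then obtain r where r: "r \<in> R" "g - r \<in> int_span ?U" by (auto simp: int_coset_eq_iff)
    have "x - (g - r) = r + (x - g)" by simp
    hence "x - (g - r) \<in> (\<Union>r\<in>R. (+) r ` unit_cube)" using r g by blast
    thus "\<exists>h\<in>int_span ?U. x - h \<in> (\<Union>r\<in>R. (+) r ` unit_cube)" using r by blast
  qed
  thus ?thesis
    by (simp add: R(5) measure_lebesgue_linear_image[OF lin unit_cube_lmeasurable] measure_unit_cube
        det_matrix_list_comb)
qed

section \<open>Bounding the Ehrhart coefficients\<close>

text \<open>Expand the rows \<open>ws\<close> from the left. By
  \<open>abs_linear_zonotope_le\<close>, replacing a row by the generators costs its factor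
  \<open>l\<close>; a generator in the span of \<open>us\<close> gives determinant zero, any other
  one is appended to \<open>us\<close>. When no row of \<open>ws\<close> is left, the determinant is
  at most an index.\<close>

lemma det_le_extension_sum:
  fixes us vs ws :: "(real^'n) list"
  assumes "distinct us" "independent (set us)" "set us \<subseteq> lattice_points" "set vs \<subseteq> lattice_points"
    "length us + length ws = CARD('n)"
    and "list_all2 (\<lambda>w l. 0 \<le> l \<and> w \<in> zonotope (- l) l vs) ws ls"
  shows "\<bar>list_det (us @ ws)\<bar> \<le> prod_list ls * extension_sum vs (length ws) (set us)"
  using assms(6,1-3,5)
proof (induction ws ls arbitrary: us rule: list_all2_induct)
  case Nil
  thus ?case using det_le_card_lattice_classes[of us] by simp
next
  case (Cons w ws l ls)
  have len: "length us + length ws + 1 = CARD('n)" using Cons.prems by simp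
  have lin: "linear (\<lambda>x. list_det (us @ x # ws))" by (rule linear_list_det[OF len])
  have pos: "0 \<le> prod_list ls"
    using Cons.hyps(2) by (induction rule: list_all2_induct) auto
  have step: "\<bar>list_det (us @ v # ws)\<bar> \<le>
      prod_list ls * (if v \<in> span (set us) then 0 else extension_sum vs (length ws) (insert v (set us)))"
    if v: "v \<in> set vs" for v
  proof (cases "v \<in> span (set us)")
    case True
    thus ?thesis using list_det_eq_0[OF len True] by simp
  next
    case False
    have "v \<notin> set us" using False span_base by blast
    hence "\<bar>list_det ((us @ [v]) @ ws)\<bar> \<le> prod_list ls * extension_sum vs (length ws) (set (us @ [v]))"
      using False v Cons.prems assms(4) len
      by (intro Cons.IH) (auto simp: independent_insert)
    thus ?thesis using False by simp
  qed
  have "\<bar>list_det (us @ w # ws)\<bar> \<le> l * (\<Sum>v\<leftarrow>vs. \<bar>list_det (us @ v # ws)\<bar>)"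
    using abs_linear_zonotope_le[OF lin] Cons.hyps(1) by blast
  also have "\<dots> \<le> l * (\<Sum>v\<leftarrow>vs. prod_list ls *
      (if v \<in> span (set us) then 0 else extension_sum vs (length ws) (insert v (set us))))"
    using Cons.hyps(1) step by (intro mult_left_mono sum_list_mono) auto
  also have "\<dots> = prod_list (l # ls) * extension_sum vs (length (w # ws)) (set us)"
    by (simp add: sum_list_const_mult)
  finally show ?case .
qed

section \<open>Completing independent vectors by short lattice vectors\<close>

lemma zonotope_mono:
  assumes "a' \<le> a" "b \<le> b'"
  shows "zonotope a b vs \<subseteq> zonotope a' b' vs"
proof (induction vs)
  case (Cons v vs)
  show ?case
  proof
    fix z assume "z \<in> zonotope a b (v # vs)"
    then obtain x t where "z = x + t *\<^sub>R v" "x \<in> zonotope a b vs" "a \<le> t" "t \<le> b" by auto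
    hence "z = x + t *\<^sub>R v \<and> x \<in> zonotope a' b' vs \<and> a' \<le> t \<and> t \<le> b'" using Cons assms by auto
    thus "z \<in> zonotope a' b' (v # vs)" unfolding zonotope.simps by blast
  qed
qed simp

lemma independent_if_not_in_span_initial:
  assumes "\<And>j. j < m \<Longrightarrow> a j \<notin> span (a ` {..<j})"
  shows "independent (a ` {..<m}) \<and> card (a ` {..<m}) = m"
  using assms
proof (induction m)
  case (Suc m)
  have IH: "independent (a ` {..<m}) \<and> card (a ` {..<m}) = m"
    by (rule Suc.IH, rule Suc.prems) simp
  have a: "a m \<notin> span (a ` {..<m})" by (rule Suc.prems) simp
  hence "a m \<notin> a ` {..<m}" by (rule contrapos_nn) (rule span_base)
  hence "card (insert (a m) (a ` {..<m})) = Suc m" using IH by simp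
  moreover have "independent (insert (a m) (a ` {..<m}))" using IH a independent_insertI by blast
  ultimately show ?case by (simp only: lessThan_Suc image_insert simp_thms)
qed (simp add: independent_empty)

text \<open>Steinitz exchange with control of length: if \<open>r\<close> vectors are present, one
  of the \<open>r + 1\<close> vectors \<open>a 0\<close>, ..., \<open>a r\<close> lies outside their
  span, and its bound is at most \<open>l r\<close>. So the new vectors get the bounds from
  \<open>l (length us)\<close> to \<open>l (n - 1)\<close>.\<close>

lemma obtain_completion:
  fixes us vs :: "(real^'n) list"
  assumes a: "\<And>j. j < CARD('n) \<Longrightarrow> a j \<in> lattice_points" "\<And>j. j < CARD('n) \<Longrightarrow> a j \<in> zonotope (- l j) (l j) vs"
      "\<And>j. j < CARD('n) \<Longrightarrow> a j \<notin> span (a ` {..<j})"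
    and l: "\<And>i j. i \<le> j \<Longrightarrow> j < CARD('n) \<Longrightarrow> l i \<le> l j" "\<And>j. j < CARD('n) \<Longrightarrow> 0 \<le> l j"
    and us: "distinct us" "independent (set us)" "set us \<subseteq> lattice_points" "length us + d = CARD('n)"
  shows "\<exists>ws. length ws = d \<and> distinct (us @ ws) \<and> independent (set (us @ ws)) \<and> set (us @ ws) \<subseteq> lattice_points \<and>
    list_all2 (\<lambda>w l. 0 \<le> l \<and> w \<in> zonotope (- l) l vs) ws (map l [length us..<CARD('n)])"
  using us
proof (induction d arbitrary: us)
  case 0
  thus ?case by simp
next
  case (Suc d)
  let ?r = "length us"
  have r: "?r < CARD('n)" using Suc.prems by simp
  have "\<exists>j\<le>?r. a j \<notin> span (set us)"
  proof (rule ccontr)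
    assume "\<not> ?thesis"
    hence "a ` {..<Suc ?r} \<subseteq> span (set us)" by auto
    moreover have "independent (a ` {..<Suc ?r})" "card (a ` {..<Suc ?r}) = Suc ?r"
      using independent_if_not_in_span_initial[of "Suc ?r" a] a(3) r by auto
    ultimately have "Suc ?r \<le> dim (span (set us))" by (metis independent_card_le_dim)
    also have "\<dots> = ?r" using Suc.prems(1,2) by (simp add: dim_span dim_eq_card_independent distinct_card)
    finally show False by simp
  qed
  then obtain j where j: "j \<le> ?r" "a j \<notin> span (set us)" by blast
  have jn: "j < CARD('n)" using j r by simp
  have nin: "a j \<notin> set us" using j span_base by blast
  have "\<exists>ws. length ws = d \<and> distinct ((us @ [a j]) @ ws) \<and> independent (set ((us @ [a j]) @ ws)) \<and>
      set ((us @ [a j]) @ ws) \<subseteq> lattice_points \<and>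
      list_all2 (\<lambda>w l. 0 \<le> l \<and> w \<in> zonotope (- l) l vs) ws (map l [length (us @ [a j])..<CARD('n)])"
    using Suc.prems j nin a(1)[OF jn] by (intro Suc.IH) (auto simp: independent_insert)
  then obtain ws where ws: "length ws = d" "distinct ((us @ [a j]) @ ws)" "independent (set ((us @ [a j]) @ ws))"
      "set ((us @ [a j]) @ ws) \<subseteq> lattice_points"
      "list_all2 (\<lambda>w l. 0 \<le> l \<and> w \<in> zonotope (- l) l vs) ws (map l [Suc ?r..<CARD('n)])" by auto
  have "a j \<in> zonotope (- l ?r) (l ?r) vs"
    using a(2)[OF jn] zonotope_mono[of "- l ?r" "- l j" "l j" "l ?r" vs] l(1)[OF j(1) r] by auto
  hence "list_all2 (\<lambda>w l. 0 \<le> l \<and> w \<in> zonotope (- l) l vs) (a j # ws) (map l [?r..<CARD('n)])"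
    using ws(5) l(2)[OF r] r by (simp add: upt_conv_Cons)
  thus ?case using ws by (intro exI[of _ "a j # ws"]) auto
qed

lemma prod_list_map_upt: "prod_list (map f [m..<n]) = (\<Prod>j\<in>{m..<n}. f j)" for f :: "nat \<Rightarrow> real"
  using prod.distinct_set_conv_list[of "[m..<n]" f] by simp

text \<open>Complete \<open>U\<close> by short vectors, bound the index by the resulting
  determinant, and expand the added rows into generators.\<close>

lemma card_lattice_classes_le_extension_sum:
  fixes U :: "(real^'n) set"
  assumes a: "\<And>j. j < CARD('n) \<Longrightarrow> a j \<in> lattice_points" "\<And>j. j < CARD('n) \<Longrightarrow> a j \<in> zonotope (- l j) (l j) vs"
      "\<And>j. j < CARD('n) \<Longrightarrow> a j \<notin> span (a ` {..<j})"
    and l: "\<And>i j. i \<le> j \<Longrightarrow> j < CARD('n) \<Longrightarrow> l i \<le> l j" "\<And>j. j < CARD('n) \<Longrightarrow> 0 \<le> l j"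
    and vs: "set vs \<subseteq> lattice_points"
    and U: "independent U" "U \<subseteq> lattice_points" "card U = i"
  shows "real (card (lattice_classes U {0})) \<le> (\<Prod>j\<in>{i..<CARD('n)}. l j) * extension_sum vs (CARD('n) - i) U"
proof -
  have fin: "finite U" "i \<le> CARD('n)" using independent_bound[OF U(1)] U(3) by auto
  obtain us where us: "set us = U" "distinct us" using finite_distinct_list[OF fin(1)] by blast
  have len: "length us = i" using us U(3) distinct_card by metis
  have "length us + (CARD('n) - i) = CARD('n)" using len fin by simp
  then obtain ws where ws: "length ws = CARD('n) - i" "distinct (us @ ws)" "independent (set (us @ ws))"
      "set (us @ ws) \<subseteq> lattice_points"
      "list_all2 (\<lambda>w l. 0 \<le> l \<and> w \<in> zonotope (- l) l vs) ws (map l [length us..<CARD('n)])"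
    using obtain_completion[OF a l us(2), of "CARD('n) - i"] us U by blast
  have n: "length us + length ws = CARD('n)" using len ws(1) fin(2) by simp
  have "real (card (lattice_classes U {0})) \<le> \<bar>list_det (us @ ws)\<bar>"
    using card_lattice_classes_le_det[OF ws(2) _ ws(3,4)] n us(1) by simp
  also have "\<dots> \<le> prod_list (map l [length us..<CARD('n)]) * extension_sum vs (length ws) (set us)"
    by (rule det_le_extension_sum[OF us(2) _ _ vs n ws(5)]) (use us U in auto)
  finally show ?thesis using ws(1) us(1) len by (simp add: prod_list_map_upt)
qed

text \<open>A bound for all independent sets of \<open>m\<close> lattice vectors is summed over the
  extensions of the smaller set \<open>U\<close> to such sets.\<close>

lemma extension_sum_le:
  fixes U :: "(real^'n) set"
  assumes C: "0 \<le> C" "\<And>U::(real^'n) set. independent U \<Longrightarrow> U \<subseteq> lattice_points \<Longrightarrow> card U = m \<Longrightarrow>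
      real (card (lattice_classes U {0})) \<le> C * extension_sum vs d U"
    and vs: "set vs \<subseteq> lattice_points"
    and U: "independent U" "U \<subseteq> lattice_points" "card U + i = m"
  shows "extension_sum vs i U \<le> C * extension_sum vs (i + d) U"
  using U
proof (induction i arbitrary: U)
  case 0
  thus ?case using C(2)[of U] by simp
next
  case (Suc i)
  have "extension_sum vs (Suc i) U \<le>
      (\<Sum>v\<leftarrow>vs. C * (if v \<in> span U then 0 else extension_sum vs (i + d) (insert v U)))"
    unfolding extension_sum.simps
  proof (rule sum_list_mono)
    fix v assume v: "v \<in> set vs"
    show "(if v \<in> span U then 0 else extension_sum vs i (insert v U)) \<le>
        C * (if v \<in> span U then 0 else extension_sum vs (i + d) (insert v U))"
    proof (cases "v \<in> span U")
      case False
      have "v \<notin> U" using False span_base by blast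
      moreover have "finite U" using independent_bound[OF Suc.prems(1)] by simp
      ultimately have "extension_sum vs i (insert v U) \<le> C * extension_sum vs (i + d) (insert v U)"
        using Suc.prems v vs False by (intro Suc.IH) (auto simp: independent_insert)
      thus ?thesis using False by simp
    qed simp
  qed
  thus ?case by (simp add: sum_list_const_mult)
qed

lemma coeff_ehrhart_from_le:
  fixes vs :: "(real^'n) list"
  assumes a: "\<And>j. j < CARD('n) \<Longrightarrow> a j \<in> lattice_points" "\<And>j. j < CARD('n) \<Longrightarrow> a j \<in> zonotope (- l j) (l j) vs"
      "\<And>j. j < CARD('n) \<Longrightarrow> a j \<notin> span (a ` {..<j})"
    and l: "\<And>i j. i \<le> j \<Longrightarrow> j < CARD('n) \<Longrightarrow> l i \<le> l j" "\<And>j. j < CARD('n) \<Longrightarrow> 0 \<le> l j"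
    and vs: "set vs \<subseteq> lattice_points" and i: "i \<le> CARD('n)"
  shows "coeff (ehrhart_from vs {}) i \<le>
    fact CARD('n) / fact i * (\<Prod>j\<in>{i..<CARD('n)}. l j) * coeff (ehrhart_from vs {}) CARD('n)"
proof -
  let ?C = "\<Prod>j\<in>{i..<CARD('n)}. l j"
  have "extension_sum vs i {} \<le> ?C * extension_sum vs (i + (CARD('n) - i)) ({} :: (real^'n) set)"
  \<comment> \<open>Starting from \<open>U = {}\<close>, the sets of \<open>i\<close> generators are
    each extended by the missing \<open>n - i\<close>.\<close>
  proof (rule extension_sum_le[where m = i])
    show "0 \<le> ?C" using l(2) by (intro prod_nonneg) auto
    show "real (card (lattice_classes U {0})) \<le> ?C * extension_sum vs (CARD('n) - i) U"
      if "independent U" "U \<subseteq> lattice_points" "card U = i" for U :: "(real^'n) set"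
      using card_lattice_classes_le_extension_sum[OF a l vs that] by blast
  qed (use vs in \<open>auto simp: independent_empty\<close>)
  hence "fact i * coeff (ehrhart_from vs {}) i \<le> ?C * (fact CARD('n) * coeff (ehrhart_from vs {}) CARD('n))"
    using i by (simp add: coeff_ehrhart_from)
  thus ?thesis by (simp add: field_simps)
qed

section \<open>Minkowski's second theorem\<close>

text \<open>The difference is \<open>c\<close> times the midpoint of \<open>p\<close> and
  \<open>- q\<close>. This halving is the source of the factor \<open>2 ^ n\<close> in Minkowski's
  theorem.\<close>

lemma diff_in_scaled_symmetric:
  assumes K: "convex K" "\<And>x. x \<in> K \<Longrightarrow> - x \<in> K"
    and xy: "x \<in> (\<lambda>x. (c / 2) *\<^sub>R x) ` K" "y \<in> (\<lambda>x. (c / 2) *\<^sub>R x) ` K"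
  shows "x - y \<in> (\<lambda>x. c *\<^sub>R x) ` K"
proof -
  obtain p q where pq: "p \<in> K" "q \<in> K" "x = (c / 2) *\<^sub>R p" "y = (c / 2) *\<^sub>R q" using xy by auto
  have "(1/2) *\<^sub>R p + (1/2) *\<^sub>R (- q) \<in> K" by (intro convexD[OF K(1)] pq K(2)) auto
  moreover have "x - y = c *\<^sub>R ((1/2) *\<^sub>R p + (1/2) *\<^sub>R (- q))"
    by (simp add: pq algebra_simps)
  ultimately show ?thesis by blast
qed

text \<open>The map stretches the last coordinates by \<open>r\<close> and translates fibrewise along the first
  ones, so that the image of \<open>T\<close> stays inside \<open>r * A\<close>.  The translation vectors are taken from a
  countable dense set, which makes the map piecewise affine.\<close>

lemma fibrewise_stretch:
  fixes A T :: "(real^'n) set" and P :: "'n \<Rightarrow> bool"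
  assumes A: "open A" "convex A" and T: "T \<in> lmeasurable" "T \<subseteq> A" and r: "1 \<le> r"
  obtains F where "F ` T \<in> lmeasurable"
    "measure lebesgue (F ` T) = r ^ card {j. \<not> P j} * measure lebesgue T"
    "F ` T \<subseteq> (\<lambda>x. r *\<^sub>R x) ` A"
    "\<And>x j. \<not> P j \<Longrightarrow> F x $ j = r * x $ j"
    "\<forall>x y. (\<forall>j. \<not> P j \<longrightarrow> x $ j = y $ j) \<longrightarrow> F x - F y = x - y"
proof -
  define comb where "comb u y = (\<chi> j. if P j then u $ j else y $ j)" for u y :: "real^'n"
  obtain Q :: "(real^'n) set" where Q: "countable Q" "\<And>X. open X \<Longrightarrow> X \<noteq> {} \<Longrightarrow> \<exists>d\<in>Q. d \<in> X"
    using countable_dense_exists by blast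
  have "Q \<noteq> {}" using Q(2)[of UNIV] by auto
  define q where "q = from_nat_into Q"
  have q: "range q = Q" unfolding q_def using Q(1) \<open>Q \<noteq> {}\<close> by (simp add: range_from_nat_into)
  \<comment> \<open>Points whose fibre, obtained by varying the \<open>P\<close> coordinates, meets
    \<open>A\<close> in the point with the \<open>P\<close> coordinates of \<open>q k\<close>.
    Density of \<open>Q\<close> provides such a \<open>k\<close> for every point of
    \<open>A\<close>.\<close>
  define D where "D k = {x. comb (q k) x \<in> A}" for k
  have "open (D k)" for k
  proof -
    have "continuous_on UNIV (\<lambda>x::real^'n. if P j then q k $ j else x $ j)" for j
      by (cases "P j") (auto intro!: continuous_intros)
    hence "continuous_on UNIV (comb (q k))" unfolding comb_def by (rule continuous_on_vec_lambda)
    hence "open (comb (q k) -` A)" by (rule open_vimage[OF A(1)])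
    thus ?thesis by (simp add: D_def vimage_def)
  qed
  hence Dm: "range D \<subseteq> sets lebesgue" by auto
  define C where "C = disjointed D"
  have Cm: "C k \<in> sets lebesgue" for k unfolding C_def using sets.range_disjointed_sets[OF Dm] by blast
  have Cdis: "disjoint_family C" unfolding C_def by (rule disjoint_family_disjointed)
  have CD: "C k \<subseteq> D k" for k unfolding C_def by (rule disjointed_subset)
  have cover: "A \<subseteq> (\<Union>k. C k)"
  proof
    fix x assume x: "x \<in> A"
    have "continuous_on UNIV (\<lambda>u::real^'n. if P j then u $ j else x $ j)" for j
      by (cases "P j") (auto intro!: continuous_intros)
    hence "continuous_on UNIV (\<lambda>u. comb u x)" unfolding comb_def by (rule continuous_on_vec_lambda)
    hence "open ((\<lambda>u. comb u x) -` A)" by (rule open_vimage[OF A(1)])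
    moreover have "comb x x = x" by (simp add: comb_def vec_eq_iff)
    hence "x \<in> (\<lambda>u. comb u x) -` A" using x by simp
    ultimately obtain d where "d \<in> Q" "comb d x \<in> A" using Q(2) by fastforce
    then obtain k where "x \<in> D k" using q by (auto simp: D_def)
    thus "x \<in> (\<Union>k. C k)" unfolding C_def UN_disjointed_eq by blast
  qed
  have Cinv: "x \<in> C k \<longleftrightarrow> y \<in> C k" if "\<And>j. \<not> P j \<Longrightarrow> x $ j = y $ j" for x y k
  proof -
    have "comb u x = comb u y" for u using that by (simp add: comb_def vec_eq_iff)
    thus ?thesis by (simp add: C_def disjointed_def D_def)
  qed
  \<comment> \<open>With \<open>c = comb (q k) x\<close>, the vector
    \<open>r ((1/r) x + (1 - 1/r) c)\<close> equals \<open>x + w k\<close> in the \<open>P\<close>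
    coordinates and \<open>r x\<close> in the others. For \<open>x\<close> in \<open>A\<close> and
    in \<open>D k\<close>, convexity therefore keeps it in \<open>r A\<close>.\<close>
  define w where "w k = (r - 1) *\<^sub>R comb (q k) 0" for k
  have wP: "w k $ j = 0" if "\<not> P j" for k j using that by (simp add: w_def comb_def)
  define kk where "kk x = (THE k. x \<in> C k)" for x
  have kk: "kk x = k" if "x \<in> C k" for x k
    unfolding kk_def using that Cdis by (intro the_equality) (auto simp: disjoint_family_on_def)
  have kk_eq: "kk x = kk y" if "\<And>j. \<not> P j \<Longrightarrow> x $ j = y $ j" for x y
    unfolding kk_def using Cinv[OF that] by simp
  define g where "g x = (\<chi> j. (if P j then 1 else r) * x $ j)" for x :: "real^'n"
  define F where "F x = g (x + w (kk x))" for x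
  define S where "S k = (+) (w k) ` (T \<inter> C k)" for k
  have Tk: "T \<inter> C k \<in> lmeasurable" for k
    using T(1) Cm[of k] by (simp add: fmeasurable_Int_fmeasurable)
  have Sm: "S k \<in> lmeasurable" for k unfolding S_def using Tk by (rule measurable_translation)
  have TU: "T = (\<Union>k. T \<inter> C k)" using T(2) cover by blast
  have FT: "F ` T = g ` (\<Union>k. S k)"
  proof (intro equalityI subsetI)
    fix y assume "y \<in> F ` T"
    then obtain x where x: "x \<in> T" "y = F x" by blast
    moreover obtain k where "x \<in> C k" using x T(2) cover by blast
    ultimately have "y = g (w k + x)" "w k + x \<in> S k" using kk by (auto simp: F_def S_def add.commute)
    thus "y \<in> g ` (\<Union>k. S k)" by blast
  next
    fix y assume "y \<in> g ` (\<Union>k. S k)"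
    then obtain x k where "x \<in> T" "x \<in> C k" "y = g (w k + x)" by (auto simp: S_def)
    hence "y = F x" "x \<in> T" using kk by (auto simp: F_def add.commute)
    thus "y \<in> F ` T" by blast
  qed
  have em: "emeasure lebesgue (\<Union>k. S k) = emeasure lebesgue T"
  proof -
    \<comment> \<open>The shifts leave the other coordinates alone, and these alone decide which
      piece \<open>C k\<close> a point belongs to.\<close>
    have disS: "disjoint_family S"
    proof (unfold disjoint_family_on_def, intro ballI impI)
      fix k m :: nat assume km: "k \<noteq> m"
      show "S k \<inter> S m = {}"
      proof (rule ccontr)
        assume "S k \<inter> S m \<noteq> {}"
        then obtain x y where xy: "x \<in> C k" "y \<in> C m" "w k + x = w m + y" by (auto simp: S_def)
        have "x $ j = y $ j" if "\<not> P j" for j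
          using arg_cong[OF xy(3), of "\<lambda>v. v $ j"] wP[OF that] by simp
        hence "y \<in> C k" using Cinv xy(1) by blast
        thus False using Cdis km xy(2) by (auto simp: disjoint_family_on_def)
      qed
    qed
    have "emeasure lebesgue (\<Union>k. S k) = (\<Sum>k. emeasure lebesgue (S k))"
      by (rule suminf_emeasure[symmetric, OF _ disS]) (use Sm in \<open>auto dest: fmeasurableD\<close>)
    also have "\<dots> = (\<Sum>k. emeasure lebesgue (T \<inter> C k))"
    proof (rule suminf_cong)
      fix k
      have "measure lebesgue (S k) = measure lebesgue (T \<inter> C k)" unfolding S_def by (rule measure_translation)
      thus "emeasure lebesgue (S k) = emeasure lebesgue (T \<inter> C k)"
        using Sm Tk by (simp add: emeasure_eq_measure2)
    qed
    also have "\<dots> = emeasure lebesgue (\<Union>k. T \<inter> C k)"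
      by (rule suminf_emeasure) (use Tk Cdis in \<open>auto dest: fmeasurableD simp: disjoint_family_on_def\<close>)
    finally show ?thesis using TU by simp
  qed
  have SUm: "(\<Union>k. S k) \<in> lmeasurable"
  proof (rule fmeasurableI)
    show "(\<Union>k. S k) \<in> sets lebesgue" using Sm by (auto dest: fmeasurableD)
    show "emeasure lebesgue (\<Union>k. S k) < \<infinity>"
      unfolding em using fmeasurableD2[OF T(1)] by (simp only: infinity_ennreal_def less_top)
  qed
  have SUeq: "measure lebesgue (\<Union>k. S k) = measure lebesgue T" using em by (simp add: measure_def)
  have "(\<Prod>j\<in>(UNIV::'n set). if P j then 1 else r) = r ^ card {j. \<not> P j}"
    by (simp add: prod.If_cases Compl_eq)
  hence pr: "\<bar>\<Prod>j\<in>(UNIV::'n set). if P j then 1 else r\<bar> = r ^ card {j. \<not> P j}" using r by simp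
  show thesis
  proof (rule that[of F])
    have g_eq: "g = (\<lambda>x. \<chi> j. (if P j then 1 else r) * x $ j)" by (rule ext) (simp add: g_def)
    show "F ` T \<in> lmeasurable" unfolding FT g_eq by (rule measurable_stretch[OF SUm])
    show "measure lebesgue (F ` T) = r ^ card {j. \<not> P j} * measure lebesgue T"
      unfolding FT g_eq measure_stretch[OF SUm] SUeq pr ..
    show "F ` T \<subseteq> (\<lambda>x. r *\<^sub>R x) ` A"
    proof (rule image_subsetI)
      fix x assume x: "x \<in> T"
      then obtain k where k: "x \<in> C k" using TU by blast
      hence c: "comb (q k) x \<in> A" using CD by (auto simp: D_def)
      have "(1 / r) *\<^sub>R x + (1 - 1 / r) *\<^sub>R comb (q k) x \<in> A"
        using x T(2) r by (intro convexD[OF A(2)] c) auto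
      moreover have "F x = r *\<^sub>R ((1 / r) *\<^sub>R x + (1 - 1 / r) *\<^sub>R comb (q k) x)"
        using r by (simp add: F_def kk[OF k] g_def w_def comb_def vec_eq_iff field_simps)
      ultimately show "F x \<in> (\<lambda>x. r *\<^sub>R x) ` A" by blast
    qed
    show "F x $ j = r * x $ j" if "\<not> P j" for x j
      using that wP[OF that] by (simp add: F_def g_def)
    show "\<forall>x y. (\<forall>j. \<not> P j \<longrightarrow> x $ j = y $ j) \<longrightarrow> F x - F y = x - y"
    proof (intro allI impI)
      fix x y :: "real^'n" assume xy: "\<forall>j. \<not> P j \<longrightarrow> x $ j = y $ j"
      have "kk x = kk y" by (rule kk_eq) (use xy in blast)
      thus "F x - F y = x - y" using xy by (auto simp: F_def g_def vec_eq_iff)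
    qed
  qed
qed

text \<open>Start from half of the first dilate, where no two points differ by a nonzero element of
  \<open>G\<close>. Passing from \<open>i\<close> to \<open>i + 1\<close> stretches the coordinates
  numbered above \<open>i\<close> by \<open>l (i + 1) / l i\<close>; this multiplies the volume by
  the right power and creates no new congruences modulo \<open>G\<close>.\<close>

lemma minkowski_transversal:
  fixes K G :: "(real^'n) set" and l :: "nat \<Rightarrow> real"
  assumes K: "open K" "convex K" "bounded K" "\<And>x. x \<in> K \<Longrightarrow> - x \<in> K"
    and l: "\<And>i. i < CARD('n) \<Longrightarrow> 0 < l i" "\<And>i j. i \<le> j \<Longrightarrow> j < CARD('n) \<Longrightarrow> l i \<le> l j"
    and G: "\<And>i g k. i < CARD('n) \<Longrightarrow> g \<in> G \<Longrightarrow> g \<in> (\<lambda>x. l i *\<^sub>R x) ` K \<Longrightarrow> i \<le> index_of k \<Longrightarrow> g $ k = 0"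
    and i: "i < CARD('n)"
  shows "\<exists>T. T \<in> lmeasurable \<and> T \<subseteq> (\<lambda>x. (l i / 2) *\<^sub>R x) ` K \<and>
    (\<forall>x\<in>T. \<forall>y\<in>T. x - y \<in> G \<longrightarrow> x = y) \<and>
    measure lebesgue T = (\<Prod>j<i. l j) * l i ^ (CARD('n) - i) * measure lebesgue K / 2 ^ CARD('n)"
  using i
proof (induction i)
  case 0
  let ?T = "(\<lambda>x. (l 0 / 2) *\<^sub>R x) ` K"
  have "open ?T" using open_scaling[of "l 0 / 2" K] K(1) l(1)[OF 0] by simp
  hence m: "?T \<in> lmeasurable"
    by (intro bounded_set_imp_lmeasurable bounded_scaling K(3)) simp
  have "measure lebesgue ?T = (l 0 / 2) ^ CARD('n) * measure lebesgue K"
    using measure_lebesgue_affine[of "l 0 / 2" 0 K] l(1)[OF 0] by simp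
  moreover have "x = y" if "x \<in> ?T" "y \<in> ?T" "x - y \<in> G" for x y
  proof -
    have "x - y \<in> (\<lambda>x. l 0 *\<^sub>R x) ` K" using diff_in_scaled_symmetric[OF K(2,4)] that by blast
    hence "(x - y) $ k = 0" for k using G[OF 0 that(3)] by blast
    thus ?thesis by (simp add: vec_eq_iff)
  qed
  ultimately show ?case using m by (intro exI[of _ ?T]) (auto simp: power_divide)
next
  case (Suc i)
  have i: "i < CARD('n)" using Suc by simp
  obtain T where T: "T \<in> lmeasurable" "T \<subseteq> (\<lambda>x. (l i / 2) *\<^sub>R x) ` K"
    "\<And>x y. x \<in> T \<Longrightarrow> y \<in> T \<Longrightarrow> x - y \<in> G \<Longrightarrow> x = y"
    "measure lebesgue T = (\<Prod>j<i. l j) * l i ^ (CARD('n) - i) * measure lebesgue K / 2 ^ CARD('n)"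
    using Suc.IH[OF i] by blast
  define r where "r = l (Suc i) / l i"
  have li: "0 < l i" using l(1)[OF i] .
  have r: "1 \<le> r" using l(2)[of i "Suc i"] Suc.prems li by (simp add: r_def)
  have rl: "r * l i = l (Suc i)" using li by (simp add: r_def)
  let ?A = "(\<lambda>x. (l i / 2) *\<^sub>R x) ` K"
  have A: "open ?A" "convex ?A" using K li by (auto intro: open_scaling convex_scaling)
  obtain F where F: "F ` T \<in> lmeasurable"
    "measure lebesgue (F ` T) = r ^ card {j::'n. \<not> index_of j \<le> i} * measure lebesgue T"
    "F ` T \<subseteq> (\<lambda>x. r *\<^sub>R x) ` ?A"
    "\<And>x j. \<not> index_of j \<le> i \<Longrightarrow> F x $ j = r * x $ j"
    "\<forall>x y. (\<forall>j. \<not> index_of j \<le> i \<longrightarrow> x $ j = y $ j) \<longrightarrow> F x - F y = x - y"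
    using fibrewise_stretch[OF A T(1,2) r, of "\<lambda>j. index_of j \<le> i"] by blast
  have FA: "F ` T \<subseteq> (\<lambda>x. (l (Suc i) / 2) *\<^sub>R x) ` K"
    using F(3) rl by (auto simp: image_image mult.assoc[symmetric])
  have idx: "inj (index_of :: 'n \<Rightarrow> nat)" "range (index_of :: 'n \<Rightarrow> nat) = {..<CARD('n)}"
    using bij_index_of[where 'n='n] by (auto simp: bij_betw_def)
  have "index_of ` {j::'n. \<not> index_of j \<le> i} = range (index_of :: 'n \<Rightarrow> nat) - {..i}" by auto
  also have "\<dots> = {Suc i..<CARD('n)}" unfolding idx(2) by auto
  finally have c: "card {j::'n. \<not> index_of j \<le> i} = CARD('n) - Suc i"
    using card_image[OF inj_on_subset[OF idx(1) subset_UNIV], of "{j. \<not> index_of j \<le> i}"] by simp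
  have "F x = F y" if xy: "x \<in> T" "y \<in> T" "F x - F y \<in> G" for x y
  proof -
    have "F x - F y \<in> (\<lambda>x. l (Suc i) *\<^sub>R x) ` K"
      using FA xy by (intro diff_in_scaled_symmetric[OF K(2,4)]) auto
    hence z: "(F x - F y) $ k = 0" if "Suc i \<le> index_of k" for k
      using G[OF Suc.prems xy(3) _ that] by blast
    \<comment> \<open>A difference in \<open>G\<close> of this size vanishes in all coordinates
      numbered above \<open>i\<close>. These were only multiplied by \<open>r\<close>, so
      \<open>x\<close> and \<open>y\<close> lie in one fibre, which \<open>F\<close> moves as a
      whole.\<close>
    have "x $ j = y $ j" if "\<not> index_of j \<le> i" for j
      using z[of j] F(4)[OF that] that r by (simp add: not_le Suc_le_eq)
    hence "F x - F y = x - y" using F(5) by blast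
    thus ?thesis using T(3)[OF xy(1,2)] xy(3) by simp
  qed
  moreover have "measure lebesgue (F ` T) =
      (\<Prod>j<Suc i. l j) * l (Suc i) ^ (CARD('n) - Suc i) * measure lebesgue K / 2 ^ CARD('n)"
  proof -
    have "CARD('n) - i = Suc (CARD('n) - Suc i)" using i by simp
    hence "l i ^ (CARD('n) - i) = l i * l i ^ (CARD('n) - Suc i)" by simp
    thus ?thesis unfolding F(2) c T(4) rl[symmetric] power_mult_distrib by simp
  qed
  ultimately show ?case using F(1) FA by (intro exI[of _ "F ` T"]) auto
qed

text \<open>In coordinates with respect to the basis \<open>a\<close>, lattice points in the dilate
  by \<open>l i\<close> have zero entries from position \<open>i\<close> on. The set from
  \<open>minkowski_transversal\<close> then packs modulo the lattice, so its image has volume at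
  most that of the unit cube.\<close>

theorem minkowski_second:
  fixes K :: "(real^'n) set" and a :: "nat \<Rightarrow> real^'n" and l :: "nat \<Rightarrow> real"
  assumes K: "open K" "convex K" "bounded K" "\<And>x. x \<in> K \<Longrightarrow> - x \<in> K"
    and l: "\<And>i. i < CARD('n) \<Longrightarrow> 0 < l i" "\<And>i j. i \<le> j \<Longrightarrow> j < CARD('n) \<Longrightarrow> l i \<le> l j"
    and a: "\<And>j. j < CARD('n) \<Longrightarrow> a j \<notin> span (a ` {..<j})"
    and min: "\<And>i z. i < CARD('n) \<Longrightarrow> z \<in> lattice_points \<Longrightarrow> z \<in> (\<lambda>x. l i *\<^sub>R x) ` K \<Longrightarrow> z \<in> span (a ` {..<i})"
  shows "(\<Prod>j<CARD('n). l j) * measure lebesgue K \<le> 2 ^ CARD('n)"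
proof -
  let ?n = "CARD('n)"
  define xs where "xs = map a [0..<?n]"
  have ind: "independent (a ` {..<?n})" "card (a ` {..<?n}) = ?n"
    using independent_if_not_in_span_initial[of ?n a] a by auto
  have sxs: "set xs = a ` {..<?n}" by (auto simp: xs_def)
  have len: "length xs = ?n" by (simp add: xs_def)
  have d: "distinct xs" by (rule card_distinct) (simp add: sxs ind len)
  let ?M = "list_comb xs"
  have lin: "linear ?M" by (rule linear_list_comb)
  have inj: "inj ?M" by (rule inj_list_comb[OF d len]) (simp add: sxs ind)
  have sur: "surj ?M" by (rule linear_injective_imp_surjective[OF lin inj refl])
  have idx: "index_of (k::'n) < ?n" for k using bij_index_of[where 'n='n] by (auto simp: bij_betw_def)
  have Max: "?M (axis k 1) = a (index_of k)" for k by (simp add: list_comb_axis xs_def idx)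
  have coord: "x $ k = 0" if x: "?M x \<in> span (a ` {..<i})" and k: "i \<le> index_of k" and i: "i < ?n" for x k i
  proof -
    let ?V = "{x::real^'n. \<forall>k. i \<le> index_of k \<longrightarrow> x $ k = 0}"
    have "subspace ?V" by (auto simp: subspace_def)
    hence "subspace (?M ` ?V)" by (rule linear_subspace_image[OF lin])
    moreover have "a ` {..<i} \<subseteq> ?M ` ?V"
    proof (rule image_subsetI)
      fix j assume j: "j \<in> {..<i}"
      then obtain m :: 'n where m: "index_of m = j"
        using bij_index_of[where 'n='n] i unfolding bij_betw_def by (metis imageE lessThan_iff order.strict_trans)
      have "axis m (1::real) $ k = 0" if "i \<le> index_of k" for k
      proof -
        have "k \<noteq> m" using that m j by auto
        thus ?thesis by (simp add: axis_def)
      qed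
      hence "axis m 1 \<in> ?V" by simp
      moreover have "a j = ?M (axis m 1)" by (simp only: Max m)
      ultimately show "a j \<in> ?M ` ?V" by (rule image_eqI[rotated])
    qed
    ultimately have "span (a ` {..<i}) \<subseteq> ?M ` ?V" by (intro span_minimal)
    then obtain y where "y \<in> ?V" "?M x = ?M y" using x by blast
    thus ?thesis using inj k by (auto simp: inj_eq)
  qed
  define K' where "K' = ?M -` K"
  have MK: "?M ` K' = K" unfolding K'_def using sur by (simp add: surj_image_vimage_eq)
  obtain N where N: "linear N" "N \<circ> ?M = id" using linear_injective_left_inverse[OF lin inj] by blast
  have K'N: "K' \<subseteq> N ` K" unfolding K'_def using N(2) by (auto simp: image_iff fun_eq_iff) metis
  have K': "open K'" "convex K'" "bounded K'" "\<And>x. x \<in> K' \<Longrightarrow> - x \<in> K'"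
  proof -
    show "open K'" unfolding K'_def
      using K(1) by (intro open_vimage linear_continuous_on) (simp_all add: lin linear_conv_bounded_linear[symmetric])
    show "convex K'" unfolding K'_def by (rule convex_linear_vimage[OF lin K(2)])
    show "bounded K'" using K'N K(3) N(1)
      by (meson bounded_linear_image bounded_subset linear_conv_bounded_linear)
    show "\<And>x. x \<in> K' \<Longrightarrow> - x \<in> K'" unfolding K'_def using K(4) by (simp add: linear_neg[OF lin])
  qed
  have K'm: "K' \<in> lmeasurable" by (rule bounded_set_imp_lmeasurable[OF K'(3)]) (use K'(1) in simp)
  have pos: "0 < ?n" by simp
  \<comment> \<open>At the last stage \<open>i = n - 1\<close> the remaining exponent is
    \<open>1\<close>, which completes the product of all \<open>l j\<close>.\<close>
  have "\<exists>T. T \<in> lmeasurable \<and> T \<subseteq> (\<lambda>x. (l (?n - 1) / 2) *\<^sub>R x) ` K' \<and>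
    (\<forall>x\<in>T. \<forall>y\<in>T. x - y \<in> ?M -` lattice_points \<longrightarrow> x = y) \<and>
    measure lebesgue T = (\<Prod>j<?n - 1. l j) * l (?n - 1) ^ (?n - (?n - 1)) * measure lebesgue K' / 2 ^ ?n"
  proof (rule minkowski_transversal[OF K' l])
    fix i g and k :: 'n
    assume i: "i < ?n" and g: "g \<in> ?M -` lattice_points" "g \<in> (\<lambda>x. l i *\<^sub>R x) ` K'" and k: "i \<le> index_of k"
    obtain x where x: "g = l i *\<^sub>R x" "x \<in> K'" using g(2) by blast
    have "?M g = l i *\<^sub>R ?M x" using x(1) by (simp add: linear_scale[OF lin])
    hence "?M g \<in> (\<lambda>x. l i *\<^sub>R x) ` K" using x(2) by (auto simp: K'_def)
    hence "?M g \<in> span (a ` {..<i})" using min[OF i] g(1) by simp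
    thus "g $ k = 0" using coord k i by blast
  qed (use pos in auto)
  then obtain T where T: "T \<in> lmeasurable"
    "\<And>x y. x \<in> T \<Longrightarrow> y \<in> T \<Longrightarrow> ?M (x - y) \<in> lattice_points \<Longrightarrow> x = y"
    "measure lebesgue T = (\<Prod>j<?n - 1. l j) * l (?n - 1) ^ (?n - (?n - 1)) * measure lebesgue K' / 2 ^ ?n"
    unfolding vimage_eq by blast
  have "{..<?n} = insert (?n - 1) {..<?n - 1}" using pos by auto
  hence "(\<Prod>j<?n. l j) = l (?n - 1) * (\<Prod>j<?n - 1. l j)" by simp
  hence mT: "measure lebesgue T = (\<Prod>j<?n. l j) * measure lebesgue K' / 2 ^ ?n"
    using T(3) pos by (simp add: mult.commute Suc_leI)
  have "measure lebesgue (?M ` T) \<le> measure lebesgue (unit_cube :: (real^'n) set)"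
  proof (rule transversal_measure_le[OF countable_lattice_points])
    show "?M ` T \<in> lmeasurable" by (rule lmeasurable_linear_image[OF lin T(1)])
    show "(unit_cube :: (real^'n) set) \<in> lmeasurable" by (rule unit_cube_lmeasurable)
    show "x = y" if "x \<in> ?M ` T" "y \<in> ?M ` T" "x - y \<in> lattice_points" for x y
      using that T(2) by (auto simp: linear_diff[OF lin])
  qed (simp_all add: lattice_points_diff unit_cube_cover)
  hence "\<bar>det (matrix ?M)\<bar> * measure lebesgue T \<le> 1"
    by (simp add: measure_lebesgue_linear_image[OF lin T(1)] measure_unit_cube)
  moreover have "measure lebesgue K = \<bar>det (matrix ?M)\<bar> * measure lebesgue K'"
    using measure_lebesgue_linear_image[OF lin K'm] MK by simp
  ultimately show ?thesis unfolding mT by (simp add: field_simps)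
qed

section \<open>Vectors attaining the successive minima\<close>

text \<open>With \<open>U = {}\<close>, \<open>last_scalar_in_fibre\<close> gives the largest
  \<open>q\<close> with \<open>q z\<close> in \<open>K\<close>; the least dilate is
  \<open>1 / q\<close>, and the ball around the origin makes \<open>q\<close> positive.\<close>

lemma obtain_least_dilate:
  fixes K :: "(real^'n) set"
  assumes K: "compact K" "ball 0 e \<subseteq> K" "0 < e" and z: "z \<noteq> 0"
  obtains m where "0 < m" "z \<in> (\<lambda>x. m *\<^sub>R x) ` K"
    "\<And>m'. 0 < m' \<Longrightarrow> z \<in> (\<lambda>x. m' *\<^sub>R x) ` K \<Longrightarrow> m \<le> m'"
proof -
  define s where "s = e / (2 * norm z)"
  have s: "0 < s" "s * norm z < e" using K(3) z by (auto simp: s_def field_simps)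
  have "z \<notin> span {}" using z by simp
  moreover have sK: "0 + s *\<^sub>R z \<in> span_sat {} K" using s K(2) by (auto simp: dist_norm)
  ultimately obtain q where q: "0 + q *\<^sub>R z \<in> span_sat {} K" "\<And>s. 0 + s *\<^sub>R z \<in> span_sat {} K \<Longrightarrow> s \<le> q"
    using last_scalar_in_fibre[OF K(1)] by metis
  have "s \<le> q" using q(2) sK by blast
  hence q0: "0 < q" using s by simp
  show thesis
  proof (rule that[of "1 / q"])
    show "0 < 1 / q" using q0 by simp
    have "z = (1 / q) *\<^sub>R (q *\<^sub>R z)" using q0 by simp
    thus "z \<in> (\<lambda>x. (1 / q) *\<^sub>R x) ` K" using q(1) by (metis add_0 image_eqI span_sat_empty)
    fix m' :: real assume m': "0 < m'" "z \<in> (\<lambda>x. m' *\<^sub>R x) ` K"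
    then obtain x where "z = m' *\<^sub>R x" "x \<in> K" by blast
    hence "(1 / m') *\<^sub>R z \<in> K" using m' by simp
    hence "1 / m' \<le> q" using q(2)[of "1 / m'"] by simp
    thus "1 / q \<le> m'" using m' q0 by (simp add: field_simps)
  qed
qed

text \<open>Some unit vector \<open>z0\<close> lies outside \<open>S\<close>. Only finitely many
  lattice points need a dilate no larger than that of \<open>z0\<close>, so the minimum is
  attained.\<close>

lemma obtain_shortest_lattice_vector:
  fixes K :: "(real^'n) set"
  assumes K: "compact K" "ball 0 e \<subseteq> K" "0 < e" and S: "subspace S" "S \<noteq> UNIV"
  obtains z m where "z \<in> lattice_points" "z \<notin> S" "0 < m" "z \<in> (\<lambda>x. m *\<^sub>R x) ` K"
    "\<And>z' m'. z' \<in> lattice_points \<Longrightarrow> z' \<notin> S \<Longrightarrow> 0 < m' \<Longrightarrow> z' \<in> (\<lambda>x. m' *\<^sub>R x) ` K \<Longrightarrow> m \<le> m'"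
proof -
  have "\<exists>m>0. z \<in> (\<lambda>x. m *\<^sub>R x) ` K \<and> (\<forall>m'>0. z \<in> (\<lambda>x. m' *\<^sub>R x) ` K \<longrightarrow> m \<le> m')" if "z \<notin> S" for z
  proof -
    have "z \<noteq> 0" using that subspace_0[OF S(1)] by blast
    thus ?thesis using obtain_least_dilate[OF K] by metis
  qed
  then obtain \<gamma> where \<gamma>: "\<And>z. z \<notin> S \<Longrightarrow> 0 < \<gamma> z" "\<And>z. z \<notin> S \<Longrightarrow> z \<in> (\<lambda>x. \<gamma> z *\<^sub>R x) ` K"
    "\<And>z m'. z \<notin> S \<Longrightarrow> 0 < m' \<Longrightarrow> z \<in> (\<lambda>x. m' *\<^sub>R x) ` K \<Longrightarrow> \<gamma> z \<le> m'"
    by metis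
  have "\<exists>i. axis i 1 \<notin> S"
  proof (rule ccontr)
    assume *: "\<not> ?thesis"
    have "x \<in> S" for x
    proof -
      have "x = (\<Sum>i\<in>UNIV. x $ i *\<^sub>R axis i 1)"
        by (simp add: vec_eq_iff axis_def if_distrib[of "\<lambda>c. _ * c"] cong: if_cong)
      also have "\<dots> \<in> S" using * by (intro subspace_sum[OF S(1)] subspace_scale[OF S(1)]) auto
      finally show ?thesis .
    qed
    thus False using S(2) by blast
  qed
  then obtain i where i: "axis i 1 \<notin> S" by blast
  define z0 :: "real^'n" where "z0 = axis i 1"
  have z0: "z0 \<in> lattice_points" "z0 \<notin> S" using i by (auto simp: z0_def lattice_points_def axis_def)
  define P where "P = {z \<in> lattice_points. z \<notin> S \<and> \<gamma> z \<le> \<gamma> z0}"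
  obtain B where B: "\<And>x. x \<in> K \<Longrightarrow> norm x \<le> B" using compact_imp_bounded[OF K(1)] bounded_iff by blast
  have "P \<subseteq> cball 0 (\<gamma> z0 * B) \<inter> lattice_points"
  proof
    fix z assume z: "z \<in> P"
    then obtain x where x: "z = \<gamma> z *\<^sub>R x" "x \<in> K" using \<gamma>(2)[of z] by (auto simp: P_def)
    have zS: "z \<notin> S" "\<gamma> z \<le> \<gamma> z0" using z by (auto simp: P_def)
    have "norm z = norm (\<gamma> z *\<^sub>R x)" by (rule arg_cong[OF x(1)])
    also have "\<dots> = \<gamma> z * norm x" using \<gamma>(1)[OF zS(1)] by simp
    also have "\<dots> \<le> \<gamma> z0 * B"
      by (rule mult_mono[OF zS(2) B[OF x(2)]]) (simp_all add: less_imp_le \<gamma>(1)[OF z0(2)])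
    finally show "z \<in> cball 0 (\<gamma> z0 * B) \<inter> lattice_points" using z by (simp add: P_def)
  qed
  hence finP: "finite P" using finite_bounded_lattice_points[of "cball 0 (\<gamma> z0 * B)"] finite_subset by blast
  have "z0 \<in> P" using z0 by (simp add: P_def)
  hence "Min (\<gamma> ` P) \<in> \<gamma> ` P" using finP by (intro Min_in) auto
  then obtain z where z: "z \<in> P" "\<gamma> z = Min (\<gamma> ` P)" by auto
  have min: "\<gamma> z \<le> \<gamma> z'" if "z' \<in> P" for z' using z(2) finP that by simp
  show thesis
  proof (rule that[of z "\<gamma> z"])
    show "z \<in> lattice_points" "z \<notin> S" using z(1) by (auto simp: P_def)
    show "0 < \<gamma> z" "z \<in> (\<lambda>x. \<gamma> z *\<^sub>R x) ` K" using \<gamma>(1,2) \<open>z \<notin> S\<close> by blast+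
    fix z' m' assume z': "z' \<in> lattice_points" "z' \<notin> S" "0 < m'" "z' \<in> (\<lambda>x. m' *\<^sub>R x) ` K"
    have "\<gamma> z \<le> \<gamma> z'"
    proof (cases "z' \<in> P")
      case False
      hence "\<gamma> z0 \<le> \<gamma> z'" using z' by (simp add: P_def)
      thus ?thesis using min[OF \<open>z0 \<in> P\<close>] by simp
    qed (rule min)
    thus "\<gamma> z \<le> m'" using \<gamma>(3) z' by force
  qed
qed

text \<open>Greedy choice of vectors attaining the successive minima. Counting starts at
  \<open>0\<close>, so \<open>l j\<close> is the minimum numbered \<open>j + 1\<close>.\<close>

definition minimal_sequence :: "(real^'n) set \<Rightarrow> nat \<Rightarrow> (nat \<Rightarrow> real^'n) \<Rightarrow> (nat \<Rightarrow> real) \<Rightarrow> bool" where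
  "minimal_sequence K N a l \<longleftrightarrow> (\<forall>j<N. a j \<in> lattice_points \<and> a j \<notin> span (a ` {..<j}) \<and>
     0 < l j \<and> a j \<in> (\<lambda>x. l j *\<^sub>R x) ` K \<and>
     (\<forall>z m. z \<in> lattice_points \<longrightarrow> z \<notin> span (a ` {..<j}) \<longrightarrow> 0 < m \<longrightarrow> z \<in> (\<lambda>x. m *\<^sub>R x) ` K \<longrightarrow> l j \<le> m))"

lemma exists_minimal_sequence:
  fixes K :: "(real^'n) set"
  assumes K: "compact K" "ball 0 e \<subseteq> K" "0 < e"
  shows "N \<le> CARD('n) \<Longrightarrow> \<exists>a l. minimal_sequence K N a l"
proof (induction N)
  case 0
  show ?case by (simp add: minimal_sequence_def)
next
  case (Suc N)
  then obtain a l where al: "minimal_sequence K N a l" by auto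
  have "dim (span (a ` {..<N})) \<le> card (a ` {..<N})" unfolding dim_span by (rule dim_le_card') simp
  also have "\<dots> \<le> N" using card_image_le[of "{..<N}" a] by simp
  finally have "dim (span (a ` {..<N})) < DIM(real^'n)" using Suc.prems by simp
  hence "span (a ` {..<N}) \<noteq> UNIV" using dim_eq_full[of "a ` {..<N}"] by auto
  then obtain z m where z: "z \<in> lattice_points" "z \<notin> span (a ` {..<N})" "0 < m" "z \<in> (\<lambda>x. m *\<^sub>R x) ` K"
    "\<And>z' m'. z' \<in> lattice_points \<Longrightarrow> z' \<notin> span (a ` {..<N}) \<Longrightarrow> 0 < m' \<Longrightarrow> z' \<in> (\<lambda>x. m' *\<^sub>R x) ` K \<Longrightarrow> m \<le> m'"
    using obtain_shortest_lattice_vector[OF K subspace_span] by blast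
  have im: "a(N := z) ` {..<j} = a ` {..<j}" if "j \<le> N" for j
    using that by (intro image_cong) auto
  have "minimal_sequence K (Suc N) (a(N := z)) (l(N := m))"
    unfolding minimal_sequence_def
  proof (intro allI impI)
    fix j assume "j < Suc N"
    then consider "j = N" | "j < N" by linarith
    thus "(a(N := z)) j \<in> lattice_points \<and> (a(N := z)) j \<notin> span (a(N := z) ` {..<j}) \<and>
     0 < (l(N := m)) j \<and> (a(N := z)) j \<in> (\<lambda>x. (l(N := m)) j *\<^sub>R x) ` K \<and>
     (\<forall>w q. w \<in> lattice_points \<longrightarrow> w \<notin> span (a(N := z) ` {..<j}) \<longrightarrow> 0 < q \<longrightarrow> w \<in> (\<lambda>x. q *\<^sub>R x) ` K \<longrightarrow>
       (l(N := m)) j \<le> q)"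
    proof cases
      case 1
      show ?thesis using z unfolding 1 im[OF order_refl] by simp
    next
      case 2
      thus ?thesis using al im[of j] unfolding minimal_sequence_def by simp
    qed
  qed
  thus ?case by blast
qed

lemma scaled_mono:
  assumes K: "convex K" "0 \<in> K" and lm: "0 \<le> l" "l \<le> m"
  shows "(\<lambda>x. l *\<^sub>R x) ` K \<subseteq> (\<lambda>x. m *\<^sub>R x) ` K"
proof (rule image_subsetI)
  fix x assume x: "x \<in> K"
  show "l *\<^sub>R x \<in> (\<lambda>x. m *\<^sub>R x) ` K"
  proof (cases "m = 0")
    case True
    thus ?thesis using lm x by auto
  next
    case False
    hence m: "0 < m" using lm by simp
    have "(l / m) *\<^sub>R x + (1 - l / m) *\<^sub>R 0 \<in> K" using lm m x K by (intro convexD[OF K(1)]) auto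
    moreover have "l *\<^sub>R x = m *\<^sub>R ((l / m) *\<^sub>R x + (1 - l / m) *\<^sub>R 0)" using m by simp
    ultimately show ?thesis by blast
  qed
qed

text \<open>The vector \<open>a j\<close> lies outside the smaller span at stage \<open>i\<close>
  and already competes there.\<close>

lemma minimal_sequence_mono:
  assumes al: "minimal_sequence K N a l" and ij: "i \<le> j" "j < N"
  shows "l i \<le> l j"
proof -
  have "span (a ` {..<i}) \<subseteq> span (a ` {..<j})" using ij by (intro span_mono image_mono) auto
  hence "a j \<notin> span (a ` {..<i})" using al ij unfolding minimal_sequence_def by blast
  thus ?thesis using al ij unfolding minimal_sequence_def by (meson order_le_less_trans)
qed

text \<open>As \<open>0\<close> lies in \<open>K\<close>, affine and linear dimension agree. A
  dilate by \<open>m < l j\<close> has all its lattice points in the span of the first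
  \<open>j\<close> vectors, while from \<open>l j\<close> on it contains \<open>j + 1\<close>
  independent ones; the infimum is thus over \<open>{l j..}\<close>.\<close>

lemma succ_min_eq:
  fixes K :: "(real^'n) set"
  assumes K: "convex K" "0 \<in> K" and al: "minimal_sequence K N a l" and j: "j < N"
  shows "succ_min K (Suc j) = l j"
proof -
  have ind: "independent (a ` {..<Suc j})" "card (a ` {..<Suc j}) = Suc j"
    using independent_if_not_in_span_initial[of "Suc j" a] al j unfolding minimal_sequence_def by auto
  have pos: "0 < l i" if "i \<le> j" for i using al j that unfolding minimal_sequence_def by auto
  have "0 < m \<and> int (Suc j) \<le> aff_dim ((\<lambda>x. m *\<^sub>R x) ` K \<inter> lattice_points) \<longleftrightarrow> l j \<le> m" for m
  proof (cases "0 < m")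
    case False
    thus ?thesis using pos[of j] by auto
  next
    case m: True
    let ?S = "(\<lambda>x. m *\<^sub>R x) ` K \<inter> (lattice_points :: (real^'n) set)"
    have "0 \<in> ?S" using K(2) by (auto intro: image_eqI[of _ _ 0])
    hence ad: "aff_dim ?S = int (dim ?S)" by (intro aff_dim_zero hull_inc)
    show ?thesis
    proof (cases "l j \<le> m")
      case True
      have "a ` {..<Suc j} \<subseteq> ?S"
      proof (rule image_subsetI)
        fix i assume "i \<in> {..<Suc j}"
        hence i: "i \<le> j" by simp
        have "l i \<le> m" using minimal_sequence_mono[OF al i j] True by simp
        hence "(\<lambda>x. l i *\<^sub>R x) ` K \<subseteq> (\<lambda>x. m *\<^sub>R x) ` K" using pos[OF i] by (intro scaled_mono K) auto
        thus "a i \<in> ?S" using al i j unfolding minimal_sequence_def by auto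
      qed
      hence "Suc j \<le> dim ?S" using independent_card_le_dim[OF _ ind(1)] ind(2) by metis
      thus ?thesis using ad True m by simp
    next
      case False
      have "?S \<subseteq> span (a ` {..<j})"
      proof
        fix z assume z: "z \<in> ?S"
        show "z \<in> span (a ` {..<j})"
        proof (rule ccontr)
          assume "z \<notin> span (a ` {..<j})"
          hence "l j \<le> m" using al j m z unfolding minimal_sequence_def by blast
          thus False using False by simp
        qed
      qed
      hence "dim ?S \<le> card (a ` {..<j})" by (intro dim_le_card) auto
      also have "\<dots> \<le> j" using card_image_le[of "{..<j}" a] by simp
      finally show ?thesis using ad False by simp
    qed
  qed
  hence "{m. m > 0 \<and> aff_dim ((\<lambda>x. m *\<^sub>R x) ` K \<inter> lattice_points) \<ge> int (Suc j)} = {l j..}"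
    by auto
  thus ?thesis by (simp add: succ_min_def)
qed

text \<open>Pass to the interior, which has the same volume by convexity. A lattice point in the
  interior of the dilate by \<open>l i\<close> lies in a strictly smaller dilate of
  \<open>K\<close>, so minimality puts it into the span of the earlier vectors.\<close>

lemma minkowski_second_minimal_sequence:
  fixes K :: "(real^'n) set"
  assumes K: "compact K" "convex K" "\<And>x. x \<in> K \<Longrightarrow> - x \<in> K"
    and al: "minimal_sequence K CARD('n) a l"
  shows "(\<Prod>j<CARD('n). l j) * measure lebesgue K \<le> 2 ^ CARD('n)"
proof -
  have "(\<Prod>j<CARD('n). l j) * measure lebesgue (interior K) \<le> 2 ^ CARD('n)"
  proof (rule minkowski_second)
    show "open (interior K)" "convex (interior K)" using K by (auto intro: convex_interior)
    show "bounded (interior K)" using K(1) compact_imp_bounded bounded_subset interior_subset by blast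
    show "- x \<in> interior K" if "x \<in> interior K" for x
    proof -
      obtain d where d: "0 < d" "ball x d \<subseteq> K" using \<open>x \<in> interior K\<close> mem_interior by blast
      have "ball (- x) d \<subseteq> K"
      proof
        fix y assume "y \<in> ball (- x) d"
        hence "- y \<in> ball x d" by (simp add: dist_norm norm_minus_commute add.commute)
        thus "y \<in> K" using d(2) K(3)[of "- y"] by auto
      qed
      thus ?thesis using d(1) mem_interior by blast
    qed
    show "0 < l i" "a i \<notin> span (a ` {..<i})" if "i < CARD('n)" for i
      using al that unfolding minimal_sequence_def by auto
    show "l i \<le> l j" if "i \<le> j" "j < CARD('n)" for i j using minimal_sequence_mono[OF al that] .
    fix i z assume i: "i < CARD('n)" and z: "z \<in> lattice_points" "z \<in> (\<lambda>x. l i *\<^sub>R x) ` interior K"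
    show "z \<in> span (a ` {..<i})"
    proof (rule ccontr)
      assume nz: "z \<notin> span (a ` {..<i})"
      have li: "0 < l i" using al i unfolding minimal_sequence_def by auto
      obtain x where x: "x \<in> interior K" "z = l i *\<^sub>R x" using z(2) by blast
      obtain d where d: "0 < d" "ball x d \<subseteq> K" using x(1) mem_interior by blast
      \<comment> \<open>Small enough that \<open>(1 + e) x\<close> stays in the ball around
        \<open>x\<close>; adding \<open>1\<close> to the norm covers \<open>x = 0\<close>.\<close>
      define e where "e = d / (norm x + 1)"
      have np: "0 < norm x + 1" by (smt (verit) norm_ge_zero)
      have e: "0 < e" using d(1) np by (simp add: e_def)
      have "e * norm x < e * (norm x + 1)" using e by simp
      also have "\<dots> = d" using np by (simp add: e_def)
      finally have "(1 + e) *\<^sub>R x \<in> ball x d" using e by (simp add: dist_norm algebra_simps)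
      hence "(1 + e) *\<^sub>R x \<in> K" using d by blast
      moreover have "z = (l i / (1 + e)) *\<^sub>R ((1 + e) *\<^sub>R x)" using x e by simp
      ultimately have "z \<in> (\<lambda>x. (l i / (1 + e)) *\<^sub>R x) ` K" by blast
      moreover have "0 < l i / (1 + e)" using li e by simp
      ultimately have "l i \<le> l i / (1 + e)" using al i z(1) nz unfolding minimal_sequence_def by blast
      thus False using li e mult_pos_pos[OF e li] by (simp add: field_simps)
    qed
  qed
  moreover have "measure lebesgue (interior K) = measure lebesgue K"
    by (rule measure_interior[OF compact_imp_bounded[OF K(1)] negligible_convex_frontier[OF K(2)]])
  ultimately show ?thesis by simp
qed

section \<open>Lattice zonotopes\<close>

lemma zonotope_ConsI:
  "x \<in> zonotope a b vs \<Longrightarrow> a \<le> t \<Longrightarrow> t \<le> b \<Longrightarrow> x + t *\<^sub>R v \<in> zonotope a b (v # vs)"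
  by auto

lemma zonotope_scale:
  assumes "0 < c"
  shows "zonotope (c * a) (c * b) vs = (\<lambda>x. c *\<^sub>R x) ` zonotope a b vs"
proof (induction vs)
  case (Cons v vs)
  show ?case
  proof (intro equalityI subsetI)
    fix z assume "z \<in> zonotope (c * a) (c * b) (v # vs)"
    then obtain x t where z: "z = c *\<^sub>R x + t *\<^sub>R v" "x \<in> zonotope a b vs" "c * a \<le> t" "t \<le> c * b"
      using Cons by auto
    have "a \<le> t / c" "t / c \<le> b" using z assms by (auto simp: field_simps)
    hence "x + (t / c) *\<^sub>R v \<in> zonotope a b (v # vs)" using z by auto
    moreover have "z = c *\<^sub>R (x + (t / c) *\<^sub>R v)" using z assms by (simp add: algebra_simps)
    ultimately show "z \<in> (\<lambda>x. c *\<^sub>R x) ` zonotope a b (v # vs)" by blast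
  next
    fix z assume "z \<in> (\<lambda>x. c *\<^sub>R x) ` zonotope a b (v # vs)"
    then obtain x t where xt: "z = c *\<^sub>R (x + t *\<^sub>R v)" "x \<in> zonotope a b vs" "a \<le> t" "t \<le> b"
      by auto
    hence z: "z = c *\<^sub>R x + (c * t) *\<^sub>R v" by (simp add: algebra_simps)
    have "c *\<^sub>R x \<in> zonotope (c * a) (c * b) vs" unfolding Cons using xt by blast
    moreover have "c * a \<le> c * t" "c * t \<le> c * b" using xt assms by auto
    ultimately show "z \<in> zonotope (c * a) (c * b) (v # vs)" unfolding z by (rule zonotope_ConsI)
  qed
qed simp

lemma zonotope_0_0: "zonotope 0 0 vs = {0}"
proof (induction vs)
  case (Cons v vs)
  show ?case by (auto simp: Cons dest: order_antisym intro!: exI[of _ "0::real"])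
qed simp

lemma zonotope_nonempty: "a \<le> b \<Longrightarrow> zonotope a b vs \<noteq> {}"
  by (induction vs) auto

lemma zonotope_eq:
  "zonotope a b vs = {\<Sum>i<length vs. t i *\<^sub>R vs ! i | t. \<forall>i<length vs. t i \<in> {a..b}}"
proof (induction vs)
  case (Cons v vs)
  show ?case
  proof (intro equalityI subsetI)
    fix z assume "z \<in> zonotope a b (v # vs)"
    then obtain s t where z: "z = (\<Sum>i<length vs. t i *\<^sub>R vs ! i) + s *\<^sub>R v"
      "\<forall>i<length vs. t i \<in> {a..b}" "a \<le> s" "s \<le> b" using Cons by auto
    let ?t = "case_nat s t"
    have "z = (\<Sum>i<length (v # vs). ?t i *\<^sub>R (v # vs) ! i)"
      unfolding z(1) length_Cons sum.lessThan_Suc_shift by simp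
    moreover have "\<forall>i<length (v # vs). ?t i \<in> {a..b}" using z by (auto simp: less_Suc_eq_0_disj)
    ultimately show "z \<in> {\<Sum>i<length (v # vs). t i *\<^sub>R (v # vs) ! i |t. \<forall>i<length (v # vs). t i \<in> {a..b}}"
      by blast
  next
    fix z assume "z \<in> {\<Sum>i<length (v # vs). t i *\<^sub>R (v # vs) ! i |t. \<forall>i<length (v # vs). t i \<in> {a..b}}"
    then obtain t where z: "z = (\<Sum>i<length (v # vs). t i *\<^sub>R (v # vs) ! i)" "\<forall>i<length (v # vs). t i \<in> {a..b}"
      by blast
    have "z = (\<Sum>i<length vs. t (Suc i) *\<^sub>R vs ! i) + t 0 *\<^sub>R v"
      unfolding z(1) length_Cons sum.lessThan_Suc_shift by simp
    moreover have "(\<Sum>i<length vs. t (Suc i) *\<^sub>R vs ! i) \<in> zonotope a b vs" unfolding Cons using z(2) by auto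
    moreover have "a \<le> t 0" "t 0 \<le> b" using z(2) by auto
    ultimately show "z \<in> zonotope a b (v # vs)" unfolding zonotope.simps by blast
  qed
qed simp

lemma lattice_zonotopeE:
  fixes Z :: "(real^'n) set"
  assumes "lattice_zonotope Z"
  obtains p vs where "p \<in> lattice_points" "set vs \<subseteq> lattice_points" "Z = (+) p ` zonotope 0 1 vs"
proof -
  obtain ps vs :: "(real^'n) list" where Z: "length ps = length vs" "set ps \<subseteq> lattice_points" "set vs \<subseteq> lattice_points"
      "Z = {\<Sum>i<length ps. ps ! i + t i *\<^sub>R vs ! i | t. \<forall>i<length ps. t i \<in> {0..1}}"
    using assms unfolding lattice_zonotope_def by blast
  define p where "p = (\<Sum>i<length ps. ps ! i)"
  have "p \<in> lattice_points" unfolding p_def using Z(2) by (intro lattice_points_sum) auto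
  moreover have "Z = (+) p ` zonotope 0 1 vs"
    unfolding Z(4) zonotope_eq Z(1) p_def sum.distrib by blast
  ultimately show thesis using that Z(3) by blast
qed

lemma diff_zonotope: "{x - y | x y. x \<in> zonotope 0 1 vs \<and> y \<in> zonotope 0 1 vs} = zonotope (-1) 1 vs"
proof (induction vs)
  case (Cons v vs)
  show ?case
  proof (intro equalityI subsetI)
    fix z assume "z \<in> {x - y | x y. x \<in> zonotope 0 1 (v # vs) \<and> y \<in> zonotope 0 1 (v # vs)}"
    then obtain x y s t where z: "z = (x + s *\<^sub>R v) - (y + t *\<^sub>R v)" "x \<in> zonotope 0 1 vs" "y \<in> zonotope 0 1 vs"
      "0 \<le> s" "s \<le> 1" "0 \<le> t" "t \<le> 1" by auto
    have "z = (x - y) + (s - t) *\<^sub>R v" using z(1) by (simp add: algebra_simps)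
    moreover have "x - y \<in> zonotope (-1) 1 vs" unfolding Cons[symmetric] using z by blast
    moreover have "-1 \<le> s - t" "s - t \<le> 1" using z by auto
    ultimately show "z \<in> zonotope (-1) 1 (v # vs)" unfolding zonotope.simps by blast
  next
    fix z assume "z \<in> zonotope (-1) 1 (v # vs)"
    then obtain w t where w: "z = w + t *\<^sub>R v" "w \<in> zonotope (-1) 1 vs" "-1 \<le> t" "t \<le> 1" by auto
    then obtain x y where xy: "w = x - y" "x \<in> zonotope 0 1 vs" "y \<in> zonotope 0 1 vs"
      unfolding Cons[symmetric] by blast
    \<comment> \<open>Splitting \<open>t\<close> into positive and negative part gives coefficients
      in \<open>[0, 1]\<close> for both points.\<close>
    have "t = max t 0 - max (- t) 0" by simp
    hence "z = (x - y) + (max t 0 - max (- t) 0) *\<^sub>R v" using w(1) xy(1) by simp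
    hence "z = (x + max t 0 *\<^sub>R v) - (y + max (- t) 0 *\<^sub>R v)" by (simp add: algebra_simps)
    moreover have "x + max t 0 *\<^sub>R v \<in> zonotope 0 1 (v # vs)" "y + max (- t) 0 *\<^sub>R v \<in> zonotope 0 1 (v # vs)"
      using xy w by (auto intro!: zonotope_ConsI simp del: zonotope.simps)
    ultimately show "z \<in> {x - y | x y. x \<in> zonotope 0 1 (v # vs) \<and> y \<in> zonotope 0 1 (v # vs)}" by blast
  qed
qed simp

lemma diff_body_translate: "diff_body ((+) p ` X) = {x - y | x y. x \<in> X \<and> y \<in> X}"
proof (intro equalityI subsetI)
  fix z assume "z \<in> diff_body ((+) p ` X)"
  then obtain x y where "z = (p + x) - (p + y)" "x \<in> X" "y \<in> X" by (auto simp: diff_body_def)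
  moreover have "(p + x) - (p + y) = x - y" by simp
  ultimately show "z \<in> {x - y | x y. x \<in> X \<and> y \<in> X}" by blast
next
  fix z assume "z \<in> {x - y | x y. x \<in> X \<and> y \<in> X}"
  then obtain x y where "z = x - y" "x \<in> X" "y \<in> X" by blast
  moreover have "x - y = (p + x) - (p + y)" by simp
  ultimately show "z \<in> diff_body ((+) p ` X)" unfolding diff_body_def by blast
qed

text \<open>Zonotopes are centrally symmetric, so the difference body is a translate of the double.
  This yields its volume \<open>2 ^ n\<close> times that of the zonotope.\<close>

lemma symmetric_zonotope_eq: "zonotope (-1) 1 vs = (\<lambda>x. 2 *\<^sub>R x + - sum_list vs) ` zonotope 0 1 vs"
proof (induction vs)
  case (Cons v vs)
  show ?case
  proof (intro equalityI subsetI)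
    fix z assume "z \<in> zonotope (-1) 1 (v # vs)"
    then obtain x t where z: "z = 2 *\<^sub>R x + - sum_list vs + t *\<^sub>R v" "x \<in> zonotope 0 1 vs" "-1 \<le> t" "t \<le> 1"
      using Cons by auto
    define s where "s = (t + 1) / 2"
    have t: "t = 2 * s - 1" by (simp add: s_def add_divide_distrib)
    have "z = 2 *\<^sub>R (x + s *\<^sub>R v) + - sum_list (v # vs)"
      unfolding z(1) t by (simp add: algebra_simps)
    moreover have "0 \<le> s" "s \<le> 1" using z by (auto simp: s_def)
    hence "x + s *\<^sub>R v \<in> zonotope 0 1 (v # vs)" by (rule zonotope_ConsI[OF z(2)])
    ultimately show "z \<in> (\<lambda>x. 2 *\<^sub>R x + - sum_list (v # vs)) ` zonotope 0 1 (v # vs)" by blast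
  next
    fix z assume "z \<in> (\<lambda>x. 2 *\<^sub>R x + - sum_list (v # vs)) ` zonotope 0 1 (v # vs)"
    then obtain x t where z: "z = 2 *\<^sub>R (x + t *\<^sub>R v) + - sum_list (v # vs)" "x \<in> zonotope 0 1 vs" "0 \<le> t" "t \<le> 1"
      by auto
    have "z = (2 *\<^sub>R x + - sum_list vs) + (2 * t - 1) *\<^sub>R v" using z(1) by (simp add: algebra_simps)
    moreover have "2 *\<^sub>R x + - sum_list vs \<in> zonotope (-1) 1 vs" unfolding Cons using z by blast
    moreover have "-1 \<le> 2 * t - 1" "2 * t - 1 \<le> 1" using z by auto
    ultimately show "z \<in> zonotope (-1) 1 (v # vs)" unfolding zonotope.simps by blast
  qed
qed simp

section \<open>The Ehrhart polynomial of a lattice zonotope and its leading coefficient\<close>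

lemma poly_eq_if_eq_on_nats:
  fixes p q :: "real poly"
  assumes "\<And>k::nat. poly p (real k) = poly q (real k)"
  shows "p = q"
proof (rule ccontr)
  assume "p \<noteq> q"
  hence "finite {x. poly (p - q) x = 0}" by (intro poly_roots_finite) simp
  moreover have "range real \<subseteq> {x. poly (p - q) x = 0}" using assms by auto
  ultimately have "finite (range real)" using finite_subset by blast
  thus False using infinite_UNIV_char_0 finite_imageD inj_of_nat by blast
qed

lemma poly_ehrhart_from_empty:
  fixes vs :: "(real^'n) list"
  assumes vs: "set vs \<subseteq> lattice_points"
  shows "poly (ehrhart_from vs {}) (real k) = real (card (zonotope 0 (real k) vs \<inter> lattice_points))"
proof -
  have "inj_on (int_coset {}) S" for S :: "(real^'n) set"
    by (auto simp: inj_on_def int_coset_eq_iff)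
  hence "card (lattice_classes {} (zonotope 0 (real k) vs)) = card (zonotope 0 (real k) vs \<inter> lattice_points)"
    by (simp add: lattice_classes_def card_image Int_commute)
  thus ?thesis using poly_ehrhart_from[of "{}" vs k] vs by simp
qed

text \<open>Translating by the lattice vector \<open>k p\<close> preserves the count, and a
  polynomial is determined by its values at the naturals, which settles the definite
  description.\<close>

lemma ehrhart_poly_zonotope:
  fixes p :: "real^'n" and vs :: "(real^'n) list"
  assumes p: "p \<in> lattice_points" and vs: "set vs \<subseteq> lattice_points"
  shows "ehrhart_poly ((+) p ` zonotope 0 1 vs) = ehrhart_from vs {}"
proof -
  let ?Z = "(+) p ` zonotope 0 1 vs"
  have deg: "degree (ehrhart_from vs ({} :: (real^'n) set)) \<le> CARD('n)"
    using degree_ehrhart_from[of "{} :: (real^'n) set" vs] by (simp add: independent_empty)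
  have cnt: "real (card ((\<lambda>x. real k *\<^sub>R x) ` ?Z \<inter> lattice_points)) = poly (ehrhart_from vs {}) (real k)" for k
  proof -
    have kZ: "(\<lambda>x. real k *\<^sub>R x) ` zonotope 0 1 vs = zonotope 0 (real k) vs"
    proof (cases "k = 0")
      case True
      thus ?thesis using zonotope_nonempty[of 0 1 vs] by (auto simp: zonotope_0_0)
    next
      case False
      thus ?thesis using zonotope_scale[of "real k" 0 1 vs] by simp
    qed
    have kp: "real k *\<^sub>R p \<in> lattice_points" using p by (simp add: lattice_points_scale)
    have "(\<lambda>x. real k *\<^sub>R x) ` ?Z = (+) (real k *\<^sub>R p) ` zonotope 0 (real k) vs"
      unfolding kZ[symmetric] image_image by (simp add: scaleR_right_distrib)
    moreover have "(real k *\<^sub>R p + x \<in> lattice_points) = (x \<in> lattice_points)" for x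
      using lattice_points_add[OF kp, of x] lattice_points_diff[OF _ kp, of "real k *\<^sub>R p + x"] by auto
    ultimately have "(\<lambda>x. real k *\<^sub>R x) ` ?Z \<inter> lattice_points =
        (+) (real k *\<^sub>R p) ` (zonotope 0 (real k) vs \<inter> lattice_points)"
      by auto
    hence "card ((\<lambda>x. real k *\<^sub>R x) ` ?Z \<inter> lattice_points) = card (zonotope 0 (real k) vs \<inter> lattice_points)"
      by (simp add: card_image)
    thus ?thesis using poly_ehrhart_from_empty[OF vs] by simp
  qed
  show ?thesis unfolding ehrhart_poly_def
  proof (rule the_equality)
    show "degree (ehrhart_from vs {}) \<le> CARD('n) \<and>
      (\<forall>k. real (card ((\<lambda>x. real k *\<^sub>R x) ` ?Z \<inter> lattice_points)) = poly (ehrhart_from vs {}) (real k))"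
      using deg cnt by blast
    fix q assume "degree q \<le> CARD('n) \<and>
      (\<forall>k. real (card ((\<lambda>x. real k *\<^sub>R x) ` ?Z \<inter> lattice_points)) = poly q (real k))"
    thus "q = ehrhart_from vs {}" using cnt by (intro poly_eq_if_eq_on_nats) simp
  qed
qed

lemma card_lattice_points_le_measure:
  fixes X Y :: "(real^'n) set"
  assumes X: "bounded X" and Y: "Y \<in> lmeasurable" and XY: "\<And>x f. x \<in> X \<Longrightarrow> f \<in> unit_cube \<Longrightarrow> x + f \<in> Y"
  shows "real (card (X \<inter> lattice_points)) \<le> measure lebesgue Y"
proof -
  let ?R = "X \<inter> lattice_points"
  have fin: "finite ?R" by (rule finite_bounded_lattice_points[OF X])
  have "real (card ?R) = measure lebesgue (\<Union>r\<in>?R. (+) r ` unit_cube)"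
    by (rule measure_lattice_cells[OF fin, symmetric]) simp
  also have "\<dots> \<le> measure lebesgue Y"
    using lmeasurable_lattice_cells[OF fin] Y XY by (intro measure_mono_fmeasurable) (auto dest: fmeasurableD)
  finally show ?thesis .
qed

text \<open>Otherwise \<open>p - V (x + c) ^ n\<close> would have a positive leading coefficient and
  become positive at large naturals.\<close>

lemma coeff_le_if_poly_le_shifted_power:
  fixes p :: "real poly"
  assumes deg: "degree p \<le> n" and le: "\<And>k::nat. 0 < k \<Longrightarrow> poly p (real k) \<le> (real k + c) ^ n * V"
  shows "coeff p n \<le> V"
proof (rule ccontr)
  assume "\<not> coeff p n \<le> V"
  define q where "q = p - smult V ([:c, 1:] ^ n)"
  have cn: "coeff q n = coeff p n - V" by (simp add: q_def coeff_linear_power)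
  have "degree q \<le> n"
    unfolding q_def using deg by (intro degree_diff_le order_trans[OF degree_smult_le]) (auto simp: degree_linear_power)
  hence "degree q = n" using cn \<open>\<not> _\<close> le_degree[of q n] by simp
  hence "0 < lead_coeff q" using cn \<open>\<not> _\<close> by simp
  then obtain N where N: "\<And>x. N \<le> x \<Longrightarrow> lead_coeff q \<le> poly q x" using poly_pinfty_gt_lc by blast
  define k where "k = Suc (nat \<lceil>N\<rceil>)"
  have "N \<le> real k" unfolding k_def by linarith
  hence "0 < poly q (real k)" using N \<open>0 < lead_coeff q\<close> by fastforce
  moreover have "poly q (real k) \<le> 0" using le[of k] by (simp add: q_def k_def mult.commute add.commute)
  ultimately show False by simp
qed

text \<open>A suitable dilate \<open>c Z\<close> contains a translate of the unit cube. Hence the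
  cubes at the lattice points of \<open>k Z\<close> fit into a translate of
  \<open>(k + c) Z\<close>, and the shift \<open>c\<close> does not affect the leading term.\<close>

lemma coeff_ehrhart_from_le_measure:
  fixes vs :: "(real^'n) list"
  assumes vs: "set vs \<subseteq> lattice_points" and ball: "ball x0 e \<subseteq> zonotope 0 1 vs" "0 < e"
  shows "coeff (ehrhart_from vs {}) CARD('n) \<le> measure lebesgue (zonotope 0 1 vs)"
proof -
  let ?Z = "zonotope 0 1 vs" and ?n = "CARD('n)"
  \<comment> \<open>Points of the unit cube have norm at most \<open>n\<close>, so dividing by
    \<open>c\<close> brings them below \<open>e\<close>.\<close>
  define c where "c = (real ?n + 1) / e"
  have c: "0 < c" using ball(2) by (simp add: c_def add_pos_pos)
  have cube: "\<exists>q\<in>?Z. f = c *\<^sub>R q - c *\<^sub>R x0" if f: "f \<in> unit_cube" for f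
  proof
    have "norm f \<le> (\<Sum>i\<in>UNIV. \<bar>f $ i\<bar>)" by (rule norm_le_l1_cart)
    also have "\<dots> \<le> (\<Sum>i\<in>(UNIV::'n set). 1)" using f by (intro sum_mono) (auto simp: unit_cube_def abs_of_nonneg less_imp_le)
    finally have "norm f < real ?n + 1" by simp
    hence "e * norm f < e * (real ?n + 1)" using ball(2) by simp
    hence "norm ((1 / c) *\<^sub>R f) < e" using c ball(2) by (simp add: c_def field_simps)
    hence "x0 + (1 / c) *\<^sub>R f \<in> ball x0 e" by (simp add: dist_norm)
    thus "x0 + (1 / c) *\<^sub>R f \<in> ?Z" using ball(1) by blast
    show "f = c *\<^sub>R (x0 + (1 / c) *\<^sub>R f) - c *\<^sub>R x0" using c by (simp add: algebra_simps)
  qed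
  have Zm: "?Z \<in> lmeasurable" by (rule lmeasurable_compact[OF compact_zonotope])
  have "poly (ehrhart_from vs {}) (real k) \<le> (real k + c) ^ ?n * measure lebesgue ?Z" if k: "0 < k" for k
  proof -
    define Y where "Y = (\<lambda>x. (real k + c) *\<^sub>R x + - (c *\<^sub>R x0)) ` ?Z"
    have kc: "0 < real k + c" using c by simp
    have kZ: "zonotope 0 (real k) vs = (\<lambda>x. real k *\<^sub>R x) ` ?Z" using zonotope_scale[of "real k" 0 1 vs] k by simp
    have Ym: "Y \<in> lmeasurable" unfolding Y_def
      by (intro lmeasurable_compact compact_continuous_image continuous_intros compact_zonotope)
    have mY: "measure lebesgue Y = (real k + c) ^ ?n * measure lebesgue ?Z"
      unfolding Y_def using measure_lebesgue_affine[of "real k + c" "- (c *\<^sub>R x0)" ?Z] kc by simp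
    have "real (card (zonotope 0 (real k) vs \<inter> lattice_points)) \<le> measure lebesgue Y"
    proof (rule card_lattice_points_le_measure[OF compact_imp_bounded[OF compact_zonotope] Ym])
      fix x f assume x: "x \<in> zonotope 0 (real k) vs" and f: "f \<in> (unit_cube :: (real^'n) set)"
      obtain p where p: "p \<in> ?Z" "x = real k *\<^sub>R p" using x kZ by blast
      obtain q where q: "q \<in> ?Z" "f = c *\<^sub>R q - c *\<^sub>R x0" using cube[OF f] by blast
      \<comment> \<open>The weights \<open>k\<close> and \<open>c\<close>, normalised to sum
        \<open>1\<close>, combine \<open>p\<close> and \<open>q\<close> into a single point of the
        convex \<open>?Z\<close>.\<close>
      define s where "s = real k / (real k + c)"
      have s: "0 \<le> s" "s \<le> 1" "(real k + c) * s = real k" "(real k + c) * (1 - s) = c"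
        using kc c by (auto simp: s_def field_simps)
      have "s *\<^sub>R p + (1 - s) *\<^sub>R q \<in> ?Z" using s by (intro convexD[OF convex_zonotope] p q) auto
      moreover have "x + f = (real k + c) *\<^sub>R (s *\<^sub>R p + (1 - s) *\<^sub>R q) + - (c *\<^sub>R x0)"
        unfolding scaleR_right_distrib scaleR_scaleR s(3,4) p(2) q(2) by simp
      ultimately show "x + f \<in> Y" unfolding Y_def by blast
    qed
    thus ?thesis using mY by (simp add: poly_ehrhart_from_empty[OF vs])
  qed
  moreover have "degree (ehrhart_from vs ({} :: (real^'n) set)) \<le> ?n"
    using degree_ehrhart_from[of "{} :: (real^'n) set" vs] by (simp add: independent_empty)
  ultimately show ?thesis by (intro coeff_le_if_poly_le_shifted_power)
qed

lemma prod_le_esym: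
  assumes "i \<le> n" "\<And>j. j \<in> {1..n} \<Longrightarrow> 0 \<le> a j"
  shows "(\<Prod>j\<in>{1..i}. a j) \<le> esym n i a"
  unfolding esym_def
proof (rule member_le_sum)
  show "{1..i} \<in> {S. S \<subseteq> {1..n} \<and> card S = i}" using assms(1) by auto
  show "0 \<le> (\<Prod>j\<in>S. a j)" if "S \<in> {S. S \<subseteq> {1..n} \<and> card S = i} - {{1..i}}" for S
    using that assms(2) by (intro prod_nonneg) auto
  show "finite {S. S \<subseteq> {1..n} \<and> card S = i}" by simp
qed

theorem theorem1p5:
  fixes Z :: "(real^'n) set" and i :: nat
  assumes "lattice_zonotope Z"
    and "aff_dim Z = int CARD('n)"
    and "i \<le> CARD('n)"
  shows "ehrhart_coeff Z i / measure lebesgue Z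
           \<le> fact CARD('n) / fact i * (\<Prod>j\<in>{i+1..CARD('n)}. succ_min (diff_body Z) j)
         \<and> ehrhart_coeff Z i \<le> fact CARD('n) / fact i * sigma_Z Z i"
proof -
  let ?n = "CARD('n)"
  obtain p vs where Z: "p \<in> lattice_points" "set vs \<subseteq> lattice_points" "Z = (+) p ` zonotope 0 1 vs"
    using lattice_zonotopeE[OF assms(1)] by blast
  let ?Z0 = "zonotope 0 1 vs" and ?K = "zonotope (-1) 1 vs" and ?V = "measure lebesgue Z"
  have DZ: "diff_body Z = ?K" unfolding Z(3) diff_body_translate by (rule diff_zonotope)
  have VZ: "?V = measure lebesgue ?Z0" unfolding Z(3) by (rule measure_translation)
  \<comment> \<open>Full dimension provides a ball in the zonotope, and hence one around the origin
    in its difference body.\<close>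
  have "aff_dim ?Z0 = DIM(real^'n)" using assms(2) unfolding Z(3) aff_dim_translation_eq by simp
  hence "affine hull ?Z0 = UNIV" by (rule iffD1[OF aff_dim_eq_full])
  hence "interior ?Z0 \<noteq> {}"
    using rel_interior_interior[of ?Z0] rel_interior_eq_empty[OF convex_zonotope, of 0 1 vs]
      zonotope_nonempty[of 0 1 vs] by simp
  then obtain x0 e where ball: "ball x0 e \<subseteq> ?Z0" "0 < e" by (meson all_not_in_conv mem_interior)
  have Kball: "ball 0 e \<subseteq> ?K"
  proof
    fix y :: "real^'n" assume "y \<in> ball 0 e"
    hence "x0 + y \<in> ?Z0" "x0 \<in> ?Z0" using ball by (auto simp: dist_norm)
    moreover have "y = (x0 + y) - x0" by simp
    ultimately show "y \<in> ?K" unfolding diff_zonotope[symmetric] by blast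
  qed
  have Ksym: "- x \<in> ?K" if x: "x \<in> ?K" for x
  proof -
    obtain u w where "x = u - w" "u \<in> ?Z0" "w \<in> ?Z0" using x unfolding diff_zonotope[symmetric] by blast
    moreover have "- (u - w) = w - u" by simp
    ultimately show ?thesis unfolding diff_zonotope[symmetric] by blast
  qed
  have K0: "0 \<in> ?K" using Kball ball(2) by auto
  obtain a l where al: "minimal_sequence ?K ?n a l"
    using exists_minimal_sequence[OF compact_zonotope Kball ball(2)] by blast
  have lpos: "0 < l j" if "j < ?n" for j using al that unfolding minimal_sequence_def by blast
  have sm: "succ_min (diff_body Z) (Suc j) = l j" if "j < ?n" for j
    unfolding DZ by (rule succ_min_eq[OF convex_zonotope K0 al that])
  have scaled: "(\<lambda>x. c *\<^sub>R x) ` ?K = zonotope (- c) c vs" if "0 < c" for c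
    using zonotope_scale[OF that, of "-1" 1 vs] by simp
  have "coeff (ehrhart_from vs {}) i \<le>
      fact ?n / fact i * (\<Prod>j\<in>{i..<?n}. l j) * coeff (ehrhart_from vs {}) ?n"
  proof (rule coeff_ehrhart_from_le[OF _ _ _ _ _ Z(2) assms(3)])
    show "a j \<in> lattice_points" "a j \<notin> span (a ` {..<j})" "0 \<le> l j" if "j < ?n" for j
      using al that unfolding minimal_sequence_def by (auto simp: less_imp_le)
    show "a j \<in> zonotope (- l j) (l j) vs" if "j < ?n" for j
      using al that unfolding minimal_sequence_def scaled[OF lpos[OF that], symmetric] by blast
    show "l i \<le> l j" if "i \<le> j" "j < ?n" for i j by (rule minimal_sequence_mono[OF al that])
  qed
  also have "\<dots> \<le> fact ?n / fact i * (\<Prod>j\<in>{i..<?n}. l j) * ?V"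
    using coeff_ehrhart_from_le_measure[OF Z(2) ball] VZ lpos
    by (intro mult_left_mono mult_nonneg_nonneg prod_nonneg) (auto simp: less_imp_le)
  finally have main: "ehrhart_coeff Z i \<le> fact ?n / fact i * (\<Prod>j\<in>{i..<?n}. l j) * ?V"
    unfolding ehrhart_coeff_def Z(3) ehrhart_poly_zonotope[OF Z(1,2)] .
  have "0 < measure lebesgue (ball x0 e)" using content_ball_pos[OF ball(2)] by simp
  also have "\<dots> \<le> ?V" unfolding VZ
    by (rule measure_mono_fmeasurable[OF ball(1)]) (auto intro: lmeasurable_compact compact_zonotope)
  finally have V: "0 < ?V" .
  have pr: "(\<Prod>j\<in>{i+1..?n}. succ_min (diff_body Z) j) = (\<Prod>j\<in>{i..<?n}. l j)"
  proof -
    have "{i+1..?n} = {Suc i..<Suc ?n}" by auto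
    hence "(\<Prod>j\<in>{i+1..?n}. succ_min (diff_body Z) j) = (\<Prod>j\<in>{i..<?n}. succ_min (diff_body Z) (Suc j))"
      by (simp only: prod.shift_bounds_Suc_ivl)
    also have "\<dots> = (\<Prod>j\<in>{i..<?n}. l j)" using sm by (intro prod.cong) auto
    finally show ?thesis .
  qed
  have pr': "(\<Prod>j\<in>{1..i}. 1 / succ_min (diff_body Z) j) = (\<Prod>j\<in>{0..<i}. 1 / l j)"
  proof -
    have "{1..i} = {Suc 0..<Suc i}" by auto
    hence "(\<Prod>j\<in>{1..i}. 1 / succ_min (diff_body Z) j) = (\<Prod>j\<in>{0..<i}. 1 / succ_min (diff_body Z) (Suc j))"
      by (simp only: prod.shift_bounds_Suc_ivl)
    also have "\<dots> = (\<Prod>j\<in>{0..<i}. 1 / l j)" using sm assms(3) by (intro prod.cong) auto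
    finally show ?thesis .
  qed
  \<comment> \<open>The \<open>2 ^ n\<close> of the difference body cancels the one in Minkowski's
    bound.\<close>
  have "measure lebesgue ?K = 2 ^ ?n * ?V"
    unfolding symmetric_zonotope_eq VZ using measure_lebesgue_affine[of 2 "- sum_list vs" ?Z0] by simp
  hence "(\<Prod>j<?n. l j) * ?V \<le> 1"
    using minkowski_second_minimal_sequence[OF compact_zonotope convex_zonotope Ksym al] by simp
  moreover have "(\<Prod>j<?n. l j) = (\<Prod>j\<in>{0..<i}. l j) * (\<Prod>j\<in>{i..<?n}. l j)"
    using prod.atLeastLessThan_concat[of 0 i ?n l] assms(3) by (simp add: atLeast0LessThan)
  moreover have P: "0 < (\<Prod>j\<in>{0..<i}. l j)" using lpos assms(3) by (intro prod_pos) auto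
  ultimately have "(\<Prod>j\<in>{i..<?n}. l j) * ?V \<le> 1 / (\<Prod>j\<in>{0..<i}. l j)"
    by (simp add: field_simps)
  also have "\<dots> = (\<Prod>j\<in>{1..i}. 1 / succ_min (diff_body Z) j)" unfolding pr' by (simp add: prod_dividef)
  \<comment> \<open>The reciprocals of the first \<open>i\<close> minima form a single summand of
    the symmetric polynomial, and the others are nonnegative.\<close>
  also have "\<dots> \<le> sigma_Z Z i" unfolding sigma_Z_def
  proof (rule prod_le_esym[OF assms(3)])
    fix j assume "j \<in> {1..?n}"
    then obtain m where "j = Suc m" "m < ?n" by (cases j) auto
    thus "0 \<le> 1 / succ_min (diff_body Z) j" using sm lpos by (simp add: less_imp_le)
  qed
  finally have "fact ?n / fact i * ((\<Prod>j\<in>{i..<?n}. l j) * ?V) \<le> fact ?n / fact i * sigma_Z Z i"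
    by (intro mult_left_mono) auto
  hence "ehrhart_coeff Z i \<le> fact ?n / fact i * sigma_Z Z i" using main by (simp only: mult.assoc)
  moreover have "ehrhart_coeff Z i / ?V \<le> fact ?n / fact i * (\<Prod>j\<in>{i..<?n}. l j)"
    using main V by (simp add: pos_divide_le_eq)
  ultimately show ?thesis unfolding pr by blast
qed

end
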